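(* Let $\mathbf{X}$ and $\mathbf{Y}$ be disjoint node sets in a maximal PDAG $\mathcal{G}=(\mathbf{V},\mathbf{E})$, such that $\mathbf{V}$ follows a causal linear model compatible with $\mathcal{G}$. Let $\mathbf{Z}_1$ and $\mathbf{Z}_2$ be two valid adjustment sets relative to $(\mathbf{X},\mathbf{Y})$ in $\mathcal{G}$, and let $\mathbf{T}=\mathbf{Z}_1\setminus\mathbf{Z}_2$ and $\mathbf{S}=\mathbf{Z}_2\setminus\mathbf{Z}_1$. If $\mathbf{Y}\perp_{\mathcal{G}}\mathbf{T}\mid\mathbf{X}\cup\mathbf{Z}_2$ and $\mathbf{X}\perp_{\mathcal{G}}\mathbf{S}\mid\mathbf{Z}_1$, then $$a.var(\hat{\tau}_{\mathbf{yx}}^{\mathbf{z}_2})\le a.var(\hat{\tau}_{\mathbf{yx}}^{\mathbf{z}_1}),$$ where the matrix inequality is entrywise.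
   Context: **Graphs.** Graphs are simple with finite node set; each edge is directed ($\to$) or undirected ($-$). A PDAG is such a graph without directed cycles; a DAG is a PDAG with only directed edges. A path is a sequence of distinct nodes in which successive nodes are adjacent; a path from a node set $\mathbf{X}$ to a node set $\mathbf{Y}$ goes from some $X\in\mathbf{X}$ to some $Y\in\mathbf{Y}$, and is proper if only its first node is in $\mathbf{X}$. A path $(V_1,\dots,V_m)$ is causal (directed) if $V_i\to V_{i+1}$ for all $i$; it is possibly causal (possibly directed) if there are no $i<j$ such that the edge $V_i\leftarrow V_j$ is in the graph; otherwise it is non-causal. $\mathrm{pa}(X,\mathcal{G})$ is the set of nodes $W$ with $W\to X$; $\mathrm{de}(X,\mathcal{G})$ (resp. $\mathrm{possde}(X,\mathcal{G})$) is the set of nodes reachable from $X$ by a directed (resp. possibly directed) path, including $X$ itself; for node sets take unions. **Maximal PDAGs.** A v-structure is $U\to V\leftarrow W$ with $U,W$ non-adjacent. A PDAG is maximal if none of these is an induced subgraph: (a) $A\to B-C$, with $A,C$ non-adjacent; (b) $A\to B\to C$, $A-C$; (c) $B\to D$, $C\to D$, $A-D$, $A-B$, $A-C$, with $B,C$ non-adjacent; (d) $B\to C\to D$, $A-B$, $A-C$, $A-D$, with $B,D$ non-adjacent. A maximal PDAG $\mathcal{G}$ represents the (non-empty) set $[\mathcal{G}]$ of DAGs that have the same adjacencies and v-structures as $\mathcal{G}$ and contain all its directed edges; for each undirected edge of $\mathcal{G}$ both orientations occur in $[\mathcal{G}]$. DAGs are special cases, with $[\mathcal{G}]=\{\mathcal{G}\}$.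 **d-separation.** A node $V$ is a collider on a path if the path contains $U\to V\leftarrow W$; a non-collider if it contains a subpath $(U,V,W)$ with $U\leftarrow V$, or $V\to W$, or $U-V-W$ with $U,W$ non-adjacent. A path is of definite status if every non-endpoint is a collider or a non-collider on it. A definite status path is blocked by a node set $\mathbf{Z}$ if it contains a non-collider in $\mathbf{Z}$ or a collider $C$ with $\mathrm{de}(C,\mathcal{G})\cap\mathbf{Z}=\emptyset$; otherwise it is open given $\mathbf{Z}$. For pairwise disjoint $\mathbf{A},\mathbf{B},\mathbf{Z}$, $\mathbf{A}\perp_{\mathcal{G}}\mathbf{B}\mid\mathbf{Z}$ means that $\mathbf{Z}$ blocks every definite status path between a node of $\mathbf{A}$ and a node of $\mathbf{B}$ (trivially true if $\mathbf{A}$ or $\mathbf{B}$ is empty). **Valid adjustment sets.** For disjoint $\mathbf{X},\mathbf{Y}$, $\mathrm{posscn}(\mathbf{X},\mathbf{Y},\mathcal{G})$ is the set of all nodes on proper possibly causal paths from $\mathbf{X}$ to $\mathbf{Y}$, excluding nodes in $\mathbf{X}$, and $\mathrm{forb}(\mathbf{X},\mathbf{Y},\mathcal{G})=\mathrm{possde}(\mathrm{posscn}(\mathbf{X},\mathbf{Y},\mathcal{G}),\mathcal{G})\cup\mathbf{X}$. A node set $\mathbf{Z}$ disjoint from $\mathbf{X}\cup\mathbf{Y}$ is a valid adjustment set relative to $(\mathbf{X},\mathbf{Y})$ in $\mathcal{G}$ if: (1) $\mathcal{G}$ is amenable relative to $(\mathbf{X},\mathbf{Y})$, i.e. every proper possibly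 causal path from $\mathbf{X}$ to $\mathbf{Y}$ starts with a directed edge out of $\mathbf{X}$; (2) $\mathbf{Z}\cap\mathrm{forb}(\mathbf{X},\mathbf{Y},\mathcal{G})=\emptyset$; (3) all proper non-causal definite status paths from $\mathbf{X}$ to $\mathbf{Y}$ are blocked by $\mathbf{Z}$. **Causal linear model.** A density $f$ of $\mathbf{V}=(V_1,\dots,V_p)$ is compatible with a causal DAG $\mathcal{D}$ if all interventional densities satisfy $f(\mathbf{v}\mid do(\mathbf{x}))=\prod_{V_i\in\mathbf{V}\setminus\mathbf{X}}f(v_i\mid\mathrm{pa}(V_i,\mathcal{D}))$ for values consistent with $\mathbf{X}=\mathbf{x}$ and $0$ otherwise. $\mathbf{V}$ follows a causal linear model compatible with a DAG $\mathcal{D}$ if its distribution is compatible with $\mathcal{D}$ and $V_i=\sum_{V_j\in\mathrm{pa}(V_i,\mathcal{D})}\alpha_{ij}V_j+\epsilon_{v_i}$, $i=1,\dots,p$, with $\alpha_{ij}\in\mathbb{R}$ and jointly independent errors $\epsilon_{v_i}$ of mean $0$ and finite variance (not necessarily Gaussian). It is compatible with a maximal PDAG $\mathcal{G}$ if it is compatible with some $\mathcal{D}\in[\mathcal{G}]$. The covariance matrix of $\mathbf{V}$ is assumed non-singular. **Asymptotic variance.** $\Sigma_{\mathbf{st}}$ is the covariance matrix between $\mathbf{S}$ and $\mathbf{T}$, $\Sigma_{\mathbf{ss}.\mathbf{t}}=\Sigma_{\mathbf{ss}}-\Sigma_{\mathbf{st}}\Sigma_{\mathbf{tt}}^{-1}\Sigma_{\mathbf{ts}}$,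 written $\sigma_{ss.\mathbf{t}}$ if $|\mathbf{S}|=1$ (juxtaposed subscripts denote unions of conditioning sets); $\mathbf{X}_{-i}=\mathbf{X}\setminus\{X_i\}$. For a valid adjustment set $\mathbf{Z}$, $\hat{\tau}^{\mathbf{z}}_{\mathbf{yx}}$ is the matrix whose $(j,i)$ entry is the least squares coefficient of $X_i$ in the regression of $Y_j$ on $\mathbf{X}$ and $\mathbf{Z}$ (an estimator of the total effect of $\mathbf{X}$ on $\mathbf{Y}$), and $a.var(\hat{\tau}^{\mathbf{z}}_{\mathbf{yx}})$ is the matrix of its asymptotic variances, with entries $$a.var(\hat{\tau}^{\mathbf{z}}_{\mathbf{yx}})_{j,i}=\frac{\sigma_{y_jy_j.\mathbf{xz}}}{\sigma_{x_ix_i.\mathbf{x}_{-i}\mathbf{z}}}.$$ *)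

theory Defs
  imports "HOL-Probability.Probability"
begin

section \<open>Graphs\<close>

text \<open>
  A pair \<open>(u, v)\<close> in \<open>dir G\<close> is the edge from \<open>u\<close> to \<open>v\<close>; an undirected edge between \<open>u\<close>
  and \<open>v\<close> is represented by both pairs \<open>(u, v)\<close> and \<open>(v, u)\<close> in \<open>und G\<close>.
\<close>

record 'v graph =
  nodes :: "'v set"
  dir :: "('v \<times> 'v) set"
  und :: "('v \<times> 'v) set"

definition simple_graph :: "'v graph \<Rightarrow> bool" where
  "simple_graph G \<longleftrightarrow>
     finite (nodes G) \<and>
     dir G \<subseteq> nodes G \<times> nodes G \<and> und G \<subseteq> nodes G \<times> nodes G \<and>
     sym (und G) \<and> irrefl (dir G) \<and> irrefl (und G) \<and>
     dir G \<inter> (dir G)\<inverse> = {} \<and> dir G \<inter> und G = {}"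

definition pdag :: "'v graph \<Rightarrow> bool" where
  "pdag G \<longleftrightarrow> simple_graph G \<and> acyclic (dir G)"

definition dag :: "'v graph \<Rightarrow> bool" where
  "dag G \<longleftrightarrow> pdag G \<and> und G = {}"

definition adj :: "'v graph \<Rightarrow> ('v \<times> 'v) set" where
  "adj G = dir G \<union> (dir G)\<inverse> \<union> und G"

definition v_structures :: "'v graph \<Rightarrow> ('v \<times> 'v \<times> 'v) set" where
  "v_structures G =
     {(u, v, w). (u, v) \<in> dir G \<and> (w, v) \<in> dir G \<and> u \<noteq> w \<and> (u, w) \<notin> adj G}"

definition pa :: "'v graph \<Rightarrow> 'v \<Rightarrow> 'v set" where
  "pa G x = {w. (w, x) \<in> dir G}"

subsection \<open>Paths\<close>

definition is_path :: "'v graph \<Rightarrow> 'v list \<Rightarrow> bool" where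
  "is_path G p \<longleftrightarrow> p \<noteq> [] \<and> distinct p \<and> set p \<subseteq> nodes G \<and>
     (\<forall>i. Suc i < length p \<longrightarrow> (p ! i, p ! Suc i) \<in> adj G)"

definition path_between :: "'v graph \<Rightarrow> 'v set \<Rightarrow> 'v set \<Rightarrow> 'v list \<Rightarrow> bool" where
  "path_between G A B p \<longleftrightarrow> is_path G p \<and> hd p \<in> A \<and> last p \<in> B"

definition proper_path :: "'v graph \<Rightarrow> 'v set \<Rightarrow> 'v set \<Rightarrow> 'v list \<Rightarrow> bool" where
  "proper_path G A B p \<longleftrightarrow> path_between G A B p \<and> set (tl p) \<inter> A = {}"

definition causal :: "'v graph \<Rightarrow> 'v list \<Rightarrow> bool" where
  "causal G p \<longleftrightarrow> (\<forall>i. Suc i < length p \<longrightarrow> (p ! i, p ! Suc i) \<in> dir G)"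

text \<open>
  The condition ranges over all pairs of nodes on the path, not only over successive ones.
  In a PDAG every causal path is possibly causal, so a path is non-causal iff it is not
  possibly causal.
\<close>

definition possibly_causal :: "'v graph \<Rightarrow> 'v list \<Rightarrow> bool" where
  "possibly_causal G p \<longleftrightarrow> (\<forall>j < length p. \<forall>i < j. (p ! j, p ! i) \<notin> dir G)"

definition non_causal :: "'v graph \<Rightarrow> 'v list \<Rightarrow> bool" where
  "non_causal G p \<longleftrightarrow> \<not> possibly_causal G p"

text \<open>
  The one-node path makes every node of the graph a (possible) descendant of itself.
\<close>

definition de :: "'v graph \<Rightarrow> 'v set \<Rightarrow> 'v set" where
  "de G A = {w. \<exists>p. path_between G A {w} p \<and> causal G p}"

definition possde :: "'v graph \<Rightarrow> 'v set \<Rightarrow> 'v set" where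
  "possde G A = {w. \<exists>p. path_between G A {w} p \<and> possibly_causal G p}"

subsection \<open>Maximal PDAGs and the DAGs they represent\<close>

definition forbidden_a :: "'v graph \<Rightarrow> bool" where
  "forbidden_a G \<longleftrightarrow> (\<exists>a b c. a \<noteq> c \<and>
     (a, b) \<in> dir G \<and> (b, c) \<in> und G \<and> (a, c) \<notin> adj G)"

definition forbidden_b :: "'v graph \<Rightarrow> bool" where
  "forbidden_b G \<longleftrightarrow> (\<exists>a b c.
     (a, b) \<in> dir G \<and> (b, c) \<in> dir G \<and> (a, c) \<in> und G)"

definition forbidden_c :: "'v graph \<Rightarrow> bool" where
  "forbidden_c G \<longleftrightarrow> (\<exists>a b c d. b \<noteq> c \<and>
     (b, d) \<in> dir G \<and> (c, d) \<in> dir G \<and>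
     (a, d) \<in> und G \<and> (a, b) \<in> und G \<and> (a, c) \<in> und G \<and> (b, c) \<notin> adj G)"

definition forbidden_d :: "'v graph \<Rightarrow> bool" where
  "forbidden_d G \<longleftrightarrow> (\<exists>a b c d. b \<noteq> d \<and>
     (b, c) \<in> dir G \<and> (c, d) \<in> dir G \<and>
     (a, b) \<in> und G \<and> (a, c) \<in> und G \<and> (a, d) \<in> und G \<and> (b, d) \<notin> adj G)"

definition maximal_pdag :: "'v graph \<Rightarrow> bool" where
  "maximal_pdag G \<longleftrightarrow> pdag G \<and>
     \<not> forbidden_a G \<and> \<not> forbidden_b G \<and> \<not> forbidden_c G \<and> \<not> forbidden_d G"

text \<open>
  Excluding the four induced subgraphs does not by itself make this set non-empty (consider an
  undirected cycle of length four); non-emptiness is part of \<open>linear_model_pdag\<close> below.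
\<close>

definition represented_dags :: "'v graph \<Rightarrow> 'v graph set" where
  "represented_dags G =
     {D. dag D \<and> nodes D = nodes G \<and> adj D = adj G \<and>
         v_structures D = v_structures G \<and> dir G \<subseteq> dir D}"

subsection \<open>d-separation\<close>

text \<open>The index \<open>i\<close> refers to an interior position, \<open>0 < i\<close> and \<open>Suc i < length p\<close>.\<close>

definition collider_at :: "'v graph \<Rightarrow> 'v list \<Rightarrow> nat \<Rightarrow> bool" where
  "collider_at G p i \<longleftrightarrow> (p ! (i - 1), p ! i) \<in> dir G \<and> (p ! Suc i, p ! i) \<in> dir G"

definition noncollider_at :: "'v graph \<Rightarrow> 'v list \<Rightarrow> nat \<Rightarrow> bool" where
  "noncollider_at G p i \<longleftrightarrow>
     (p ! i, p ! (i - 1)) \<in> dir G \<or> (p ! i, p ! Suc i) \<in> dir G \<or>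
     ((p ! (i - 1), p ! i) \<in> und G \<and> (p ! i, p ! Suc i) \<in> und G \<and>
      (p ! (i - 1), p ! Suc i) \<notin> adj G)"

definition definite_status :: "'v graph \<Rightarrow> 'v list \<Rightarrow> bool" where
  "definite_status G p \<longleftrightarrow>
     (\<forall>i. 0 < i \<and> Suc i < length p \<longrightarrow> collider_at G p i \<or> noncollider_at G p i)"

definition blocked :: "'v graph \<Rightarrow> 'v set \<Rightarrow> 'v list \<Rightarrow> bool" where
  "blocked G Z p \<longleftrightarrow> (\<exists>i. 0 < i \<and> Suc i < length p \<and>
     (noncollider_at G p i \<and> p ! i \<in> Z \<or> collider_at G p i \<and> de G {p ! i} \<inter> Z = {}))"

definition d_separated :: "'v graph \<Rightarrow> 'v set \<Rightarrow> 'v set \<Rightarrow> 'v set \<Rightarrow> bool" where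
  "d_separated G A B Z \<longleftrightarrow>
     (\<forall>p. path_between G A B p \<and> definite_status G p \<longrightarrow> blocked G Z p)"

subsection \<open>Valid adjustment sets\<close>

definition posscn :: "'v graph \<Rightarrow> 'v set \<Rightarrow> 'v set \<Rightarrow> 'v set" where
  "posscn G X Y = \<Union> {set p |p. proper_path G X Y p \<and> possibly_causal G p} - X"

definition forb :: "'v graph \<Rightarrow> 'v set \<Rightarrow> 'v set \<Rightarrow> 'v set" where
  "forb G X Y = possde G (posscn G X Y) \<union> X"

definition amenable :: "'v graph \<Rightarrow> 'v set \<Rightarrow> 'v set \<Rightarrow> bool" where
  "amenable G X Y \<longleftrightarrow>
     (\<forall>p. proper_path G X Y p \<and> possibly_causal G p \<longrightarrow> (p ! 0, p ! 1) \<in> dir G)"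

definition valid_adjustment_set :: "'v graph \<Rightarrow> 'v set \<Rightarrow> 'v set \<Rightarrow> 'v set \<Rightarrow> bool" where
  "valid_adjustment_set G X Y Z \<longleftrightarrow>
     Z \<subseteq> nodes G \<and> Z \<inter> (X \<union> Y) = {} \<and>
     amenable G X Y \<and>
     Z \<inter> forb G X Y = {} \<and>
     (\<forall>p. proper_path G X Y p \<and> non_causal G p \<and> definite_status G p \<longrightarrow> blocked G Z p)"

section \<open>Causal linear models\<close>

text \<open>
  \<open>V i\<close> is the random variable at node \<open>i\<close>, on the probability space \<open>M\<close>.  Densities are
  taken with respect to products of arbitrary sigma-finite reference measures \<open>\<nu> i\<close> on the
  real line (Lebesgue measure for continuous variables, counting measures for discrete ones).
\<close>

definition random_vector :: "('v \<Rightarrow> 'w \<Rightarrow> real) \<Rightarrow> 'v set \<Rightarrow> 'w \<Rightarrow> 'v \<Rightarrow> real" where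
  "random_vector V A = (\<lambda>\<omega>. \<lambda>i\<in>A. V i \<omega>)"

text \<open>
  \<open>k\<close> is a version of the conditional density of \<open>V i\<close> given \<open>(V j)\<close>, \<open>j \<in> P\<close>: its
  argument is a vector indexed by \<open>insert i P\<close>, it integrates to one in the coordinate \<open>i\<close>,
  and its product with a density of the conditioning vector is a joint density.
\<close>

definition conditional_density ::
  "'w measure \<Rightarrow> ('v \<Rightarrow> real measure) \<Rightarrow> ('v \<Rightarrow> 'w \<Rightarrow> real) \<Rightarrow> 'v \<Rightarrow> 'v set \<Rightarrow>
   (('v \<Rightarrow> real) \<Rightarrow> ennreal) \<Rightarrow> bool" where
  "conditional_density M \<nu> V i P k \<longleftrightarrow>
     k \<in> borel_measurable (\<Pi>\<^sub>M j\<in>insert i P. \<nu> j) \<and>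
     (\<forall>u\<in>space (\<Pi>\<^sub>M j\<in>P. \<nu> j). (\<integral>\<^sup>+ t. k (u(i := t)) \<partial>\<nu> i) = 1) \<and>
     (\<exists>g. distributed M (\<Pi>\<^sub>M j\<in>P. \<nu> j) (random_vector V P) g \<and>
          distributed M (\<Pi>\<^sub>M j\<in>insert i P. \<nu> j) (random_vector V (insert i P))
            (\<lambda>v. k v * g (restrict v P)))"

text \<open>
  \<open>f W x\<close> is the interventional density of the variables under \<open>do(W = x)\<close>, with \<open>x\<close>
  a vector indexed by \<open>W\<close>; \<open>W = {}\<close> gives the observational density.  The interventional
  densities are given data of the causal model: they are not determined by the law of \<open>V\<close>
  alone, but are tied to it by the truncated factorization.  Conditional densities are
  unique only up to null sets, so one version of each is chosen for all interventions.
\<close>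

definition compatible_density ::
  "'w measure \<Rightarrow> ('v \<Rightarrow> real measure) \<Rightarrow> ('v \<Rightarrow> 'w \<Rightarrow> real) \<Rightarrow>
   ('v set \<Rightarrow> ('v \<Rightarrow> real) \<Rightarrow> ('v \<Rightarrow> real) \<Rightarrow> ennreal) \<Rightarrow> 'v graph \<Rightarrow> bool" where
  "compatible_density M \<nu> V f D \<longleftrightarrow>
     (\<forall>i\<in>nodes D. sigma_finite_measure (\<nu> i) \<and> sets (\<nu> i) = sets borel) \<and>
     distributed M (\<Pi>\<^sub>M i\<in>nodes D. \<nu> i) (random_vector V (nodes D)) (f {} (\<lambda>_. undefined)) \<and>
     (\<exists>k. (\<forall>i\<in>nodes D. conditional_density M \<nu> V i (pa D i) (k i)) \<and>
          (\<forall>W x v. W \<subseteq> nodes D \<longrightarrow> x \<in> W \<rightarrow>\<^sub>E UNIV \<longrightarrow> v \<in> nodes D \<rightarrow>\<^sub>E UNIV \<longrightarrow>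
             f W x v =
               (if restrict v W = x
                then \<Prod>i\<in>nodes D - W. k i (restrict v (insert i (pa D i)))
                else 0)))"

definition linear_model_dag ::
  "'w measure \<Rightarrow> ('v \<Rightarrow> real measure) \<Rightarrow> ('v \<Rightarrow> 'w \<Rightarrow> real) \<Rightarrow>
   ('v set \<Rightarrow> ('v \<Rightarrow> real) \<Rightarrow> ('v \<Rightarrow> real) \<Rightarrow> ennreal) \<Rightarrow> 'v graph \<Rightarrow> bool" where
  "linear_model_dag M \<nu> V f D \<longleftrightarrow>
     prob_space M \<and> (\<forall>i\<in>nodes D. V i \<in> borel_measurable M) \<and>
     compatible_density M \<nu> V f D \<and>
     (\<exists>\<alpha> :: 'v \<Rightarrow> 'v \<Rightarrow> real. \<exists>\<epsilon> :: 'v \<Rightarrow> 'w \<Rightarrow> real.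
        prob_space.indep_vars M (\<lambda>_. borel) \<epsilon> (nodes D) \<and>
        (\<forall>i\<in>nodes D. integrable M (\<epsilon> i) \<and> integrable M (\<lambda>\<omega>. (\<epsilon> i \<omega>)\<^sup>2) \<and>
           prob_space.expectation M (\<epsilon> i) = 0 \<and>
           (AE \<omega> in M. V i \<omega> = (\<Sum>j\<in>pa D i. \<alpha> i j * V j \<omega>) + \<epsilon> i \<omega>)))"

definition linear_model_pdag ::
  "'w measure \<Rightarrow> ('v \<Rightarrow> real measure) \<Rightarrow> ('v \<Rightarrow> 'w \<Rightarrow> real) \<Rightarrow>
   ('v set \<Rightarrow> ('v \<Rightarrow> real) \<Rightarrow> ('v \<Rightarrow> real) \<Rightarrow> ennreal) \<Rightarrow> 'v graph \<Rightarrow> bool" where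
  "linear_model_pdag M \<nu> V f G \<longleftrightarrow> (\<exists>D\<in>represented_dags G. linear_model_dag M \<nu> V f D)"

section \<open>Asymptotic variances\<close>

definition cov :: "'w measure \<Rightarrow> ('v \<Rightarrow> 'w \<Rightarrow> real) \<Rightarrow> 'v \<Rightarrow> 'v \<Rightarrow> real" where
  "cov M V a b = prob_space.expectation M (\<lambda>\<omega>.
     (V a \<omega> - prob_space.expectation M (V a)) * (V b \<omega> - prob_space.expectation M (V b)))"

text \<open>
  Covariance matrices are indexed by arbitrary finite node sets, so matrices are functions of
  two indices, read on \<open>I \<times> I\<close>.  The definitions mirror \<^const>\<open>invertible\<close> and
  \<^const>\<open>matrix_inv\<close>.
\<close>

definition inverse_matrices_on ::
  "'v set \<Rightarrow> ('v \<Rightarrow> 'v \<Rightarrow> real) \<Rightarrow> ('v \<Rightarrow> 'v \<Rightarrow> real) \<Rightarrow> bool" where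
  "inverse_matrices_on I A B \<longleftrightarrow>
     (\<forall>i\<in>I. \<forall>j\<in>I. (\<Sum>k\<in>I. A i k * B k j) = (if i = j then 1 else 0) \<and>
                  (\<Sum>k\<in>I. B i k * A k j) = (if i = j then 1 else 0))"

definition nonsingular_on :: "'v set \<Rightarrow> ('v \<Rightarrow> 'v \<Rightarrow> real) \<Rightarrow> bool" where
  "nonsingular_on I A \<longleftrightarrow> (\<exists>B. inverse_matrices_on I A B)"

definition matrix_inv_on :: "'v set \<Rightarrow> ('v \<Rightarrow> 'v \<Rightarrow> real) \<Rightarrow> 'v \<Rightarrow> 'v \<Rightarrow> real" where
  "matrix_inv_on I A = (SOME B. inverse_matrices_on I A B)"

text \<open>The \<open>(a, b)\<close> entry of the conditional covariance matrix given the node set \<open>T\<close>.\<close>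

definition cond_cov :: "'w measure \<Rightarrow> ('v \<Rightarrow> 'w \<Rightarrow> real) \<Rightarrow> 'v set \<Rightarrow> 'v \<Rightarrow> 'v \<Rightarrow> real" where
  "cond_cov M V T a b =
     cov M V a b -
     (\<Sum>i\<in>T. \<Sum>j\<in>T. cov M V a i * matrix_inv_on T (cov M V) i j * cov M V j b)"

text \<open>
  \<open>a_var M V X Z y x\<close> is the asymptotic variance of the least squares coefficient of \<open>x \<in> X\<close>
  in the regression of \<open>y\<close> on \<open>X \<union> Z\<close>, given by its closed form, which applies to valid
  adjustment sets \<open>Z\<close>.
\<close>

definition a_var ::
  "'w measure \<Rightarrow> ('v \<Rightarrow> 'w \<Rightarrow> real) \<Rightarrow> 'v set \<Rightarrow> 'v set \<Rightarrow> 'v \<Rightarrow> 'v \<Rightarrow> real" where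
  "a_var M V X Z y x = cond_cov M V (X \<union> Z) y y / cond_cov M V ((X - {x}) \<union> Z) x x"

end

theory Submission
  imports Defs
begin

text \<open>
  Both the numerator and the denominator of the asymptotic variance are residual variances of
  linear regressions, and a residual variance can only decrease when regressors are added.
  Write \<open>X\<^sub>-\<close> for \<open>X - {x}\<close>.  Given \<open>X \<union> Z2\<close>, the additional regressors \<open>T\<close> carry no
  information about \<open>y\<close>, so
  \<open>\<sigma>\<^sub>y\<^sub>y(X \<union> Z2) = \<sigma>\<^sub>y\<^sub>y(X \<union> Z1 \<union> Z2) \<le> \<sigma>\<^sub>y\<^sub>y(X \<union> Z1)\<close>.  The nodes \<open>S\<close> are uncorrelated with
  \<open>X\<close> given \<open>Z1\<close>, hence (weak union) with \<open>x\<close> given \<open>X\<^sub>- \<union> Z1\<close>, so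
  \<open>\<sigma>\<^sub>x\<^sub>x(X\<^sub>- \<union> Z1) = \<sigma>\<^sub>x\<^sub>x(X\<^sub>- \<union> Z1 \<union> Z2) \<le> \<sigma>\<^sub>x\<^sub>x(X\<^sub>- \<union> Z2)\<close>.  The quotient for \<open>Z2\<close> thus has
  the smaller numerator and the larger denominator.

  What remains is that a d-separation in the maximal PDAG \<open>G\<close> makes the corresponding partial
  covariances vanish.  Let \<open>D\<close> be the represented DAG that generates the variables.

  From \<open>G\<close> to \<open>D\<close> (\<open>d_separated_no_open_walk\<close>): a walk of \<open>D\<close> that is open given \<open>Z\<close> yields an
  open definite status path of \<open>G\<close> between the same nodes.  Take an open walk of minimal length,
  and among these one whose nodes have the least total distance to \<open>Z\<close>.  Minimal length makes it
  a path on which every triple whose outer nodes are adjacent is a non-collider with an edge that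
  \<open>G\<close> directs out of its middle node; the other triples have a definite status because \<open>G\<close> and
  \<open>D\<close> have the same v-structures and because of the exclusion of \<open>A \<rightarrow> B - C\<close>.  Minimal distance
  makes the colliders ancestors of \<open>Z\<close> in \<open>G\<close>, not only in \<open>D\<close>: the first edge of a shortest
  directed path of \<open>D\<close> from the collider to \<open>Z\<close> is directed in \<open>G\<close>, since otherwise the collider
  could be moved one step closer to \<open>Z\<close>, and then all later edges are directed in \<open>G\<close> as well.

  From \<open>D\<close> to covariances (\<open>no_open_walk_partial_cov\<close>): let \<open>A\<close> be the set of ancestors of
  \<open>{a, b} \<union> Z\<close> and let \<open>R\<close> contain the nodes of \<open>A - Z\<close> from which an open walk leads to \<open>a\<close>.  If
  \<open>b \<notin> R\<close>, then a node of \<open>A\<close> and its parents, once they meet \<open>R\<close>, lie in \<open>R \<union> Z\<close>.  The residual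
  of \<open>a\<close> in the regression on \<open>A - R\<close> is a combination of the errors of \<open>A\<close>, and only errors of
  nodes whose family meets \<open>R\<close> occur in it.  Hence it involves no variable of \<open>A - R - Z\<close>: it is
  the residual of \<open>a\<close> in the regression on \<open>Z\<close>, and it is orthogonal to \<open>b\<close>.
\<close>

section \<open>Open walks in a directed acyclic graph\<close>

definition anc :: "('v \<times> 'v) set \<Rightarrow> 'v set \<Rightarrow> 'v set" where
  "anc E Z = {v. \<exists>z\<in>Z. (v, z) \<in> E\<^sup>*}"

text \<open>
  The condition for the triple \<open>(x, y, z)\<close> not to block a walk.  A collider has to be an ancestor
  of \<open>Z\<close>, which is the usual condition that it has a descendant in \<open>Z\<close>.
\<close>

definition passes :: "('v \<times> 'v) set \<Rightarrow> 'v set \<Rightarrow> 'v \<Rightarrow> 'v \<Rightarrow> 'v \<Rightarrow> bool" where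
  "passes E Z x y z \<longleftrightarrow> (if (x, y) \<in> E \<and> (z, y) \<in> E then y \<in> anc E Z else y \<notin> Z)"

text \<open>
  Nodes may be repeated.  This makes it easy to concatenate open walks; a shortest one turns out
  to be a path.
\<close>

fun open_walk :: "('v \<times> 'v) set \<Rightarrow> 'v set \<Rightarrow> 'v list \<Rightarrow> bool" where
  "open_walk E Z [] \<longleftrightarrow> False"
| "open_walk E Z [x] \<longleftrightarrow> True"
| "open_walk E Z [x, y] \<longleftrightarrow> (x, y) \<in> E \<union> E\<inverse>"
| "open_walk E Z (x # y # z # p) \<longleftrightarrow>
     (x, y) \<in> E \<union> E\<inverse> \<and> passes E Z x y z \<and> open_walk E Z (y # z # p)"

lemma subset_anc: "z \<in> Z \<Longrightarrow> z \<in> anc E Z"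
  by (auto simp: anc_def)

lemma anc_edge: "(u, v) \<in> E \<Longrightarrow> v \<in> anc E Z \<Longrightarrow> u \<in> anc E Z"
  by (auto simp: anc_def intro: converse_rtrancl_into_rtrancl)

lemma acyclic_asym: "acyclic E \<Longrightarrow> (u, v) \<in> E \<Longrightarrow> (v, u) \<notin> E"
  by (meson acyclic_def r_into_trancl trancl_trans)

text \<open>
  Two open walks can be glued along a common edge, because being open is a condition on
  consecutive triples only.  All modifications of walks below are reduced to this.
\<close>

lemma open_walk_join:
  "open_walk E Z (l @ x # y # r) \<longleftrightarrow> open_walk E Z (l @ [x, y]) \<and> open_walk E Z (x # y # r)"
proof (induction l)
  case Nil
  show ?case by (cases r) auto
next
  case (Cons t l)
  show ?case
  proof (cases l)
    case Nil
    then show ?thesis by (cases r) auto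
  next
    case (Cons s l')
    then show ?thesis using Cons.IH by (cases l') auto
  qed
qed

lemma open_walk_suffix: "open_walk E Z (l @ x # r) \<Longrightarrow> open_walk E Z (x # r)"
proof (induction l)
  case (Cons t l)
  show ?case
    using Cons by (cases "l @ x # r" rule: list.exhaust; cases "tl (l @ x # r)") auto
qed simp

lemma open_walk_prefix: "open_walk E Z (l @ x # r) \<Longrightarrow> open_walk E Z (l @ [x])"
proof (cases r)
  case (Cons y r')
  assume "open_walk E Z (l @ x # r)"
  then have *: "open_walk E Z (l @ [x, y])" using Cons open_walk_join[of E Z l x y r'] by simp
  show ?thesis
  proof (cases l rule: rev_cases)
    case (snoc l' t)
    then show ?thesis using * open_walk_join[of E Z l' t x "[y]"] by simp
  qed simp
qed simp

lemma passes_sym: "passes E Z x y z \<longleftrightarrow> passes E Z z y x"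
  by (auto simp: passes_def)

lemma open_walk_rev: "open_walk E Z p \<Longrightarrow> open_walk E Z (rev p)"
proof (induction p rule: open_walk.induct)
  case (4 E Z x y z p)
  then have "(y, z) \<in> E \<union> E\<inverse>" by (cases p) auto
  then show ?case
    using 4 open_walk_join[of E Z "rev p" z y "[x]"] by (auto simp: passes_sym)
qed auto

text \<open>
  A walk leaving \<open>x\<close> along an arrow either keeps following arrows to its end, or meets a
  collider below \<open>x\<close>, which has to be an ancestor of \<open>Z\<close>.
\<close>

lemma open_walk_forward:
  "open_walk E Z (x # y # q) \<Longrightarrow> (x, y) \<in> E \<Longrightarrow> x \<in> anc E Z \<or> (x, last (y # q)) \<in> E\<^sup>+"
proof (induction q arbitrary: x y)
  case Nil
  then show ?case by auto
next
  case (Cons z q)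
  show ?case
  proof (cases "(y, z) \<in> E")
    case True
    then have "y \<in> anc E Z \<or> (y, last (z # q)) \<in> E\<^sup>+" using Cons by auto
    then show ?thesis using Cons.prems(2) by (auto intro: anc_edge trancl_into_trancl2)
  next
    case False
    then have "(z, y) \<in> E" using Cons.prems(1) by (cases q) auto
    then have "y \<in> anc E Z" using Cons.prems by (auto simp: passes_def)
    then show ?thesis using Cons.prems(2) by (auto intro: anc_edge)
  qed
qed

definition shortest_open_walk :: "('v \<times> 'v) set \<Rightarrow> 'v set \<Rightarrow> 'v list \<Rightarrow> bool" where
  "shortest_open_walk E Z p \<longleftrightarrow> open_walk E Z p \<and>
     (\<forall>q. open_walk E Z q \<and> hd q = hd p \<and> last q = last p \<longrightarrow> length p \<le> length q)"

lemma shortest_open_walk_rev: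
  assumes "shortest_open_walk E Z p"
  shows "shortest_open_walk E Z (rev p)"
  unfolding shortest_open_walk_def
proof safe
  show "open_walk E Z (rev p)"
    using assms open_walk_rev by (auto simp: shortest_open_walk_def)
  fix q assume q: "open_walk E Z q" "hd q = hd (rev p)" "last q = last (rev p)"
  have "q \<noteq> []" "p \<noteq> []" using q assms by (auto simp: shortest_open_walk_def)
  then have "hd (rev q) = hd p" "last (rev q) = last p"
    using q by (auto simp: hd_rev last_rev)
  then show "length (rev p) \<le> length q"
    using assms open_walk_rev[OF q(1)] unfolding shortest_open_walk_def by fastforce
qed

text \<open>
  A repeated node \<open>x\<close> can be spliced out.  If the splice makes \<open>x\<close> a non-collider, then one of the
  two visits already was one, so \<open>x \<notin> Z\<close>.  If it makes \<open>x\<close> a collider, then the loop from \<open>x\<close> to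
  \<open>x\<close> enters the first visit with an arrow, or it starts with an arrow out of \<open>x\<close> and, as there
  are no directed cycles, meets a collider below \<open>x\<close>; in both cases \<open>x\<close> is an ancestor of \<open>Z\<close>.
\<close>

lemma shortest_open_walk_distinct:
  assumes "acyclic E" "shortest_open_walk E Z p"
  shows "distinct p"
proof (rule ccontr)
  assume "\<not> distinct p"
  then obtain l m r x where p: "p = l @ [x] @ m @ [x] @ r"
    using not_distinct_decomp by blast
  have ow: "open_walk E Z p" using assms(2) by (simp add: shortest_open_walk_def)
  have irr: "(x, x) \<notin> E\<^sup>+" using assms(1) by (auto simp: acyclic_def)
  have loop: "open_walk E Z (x # m @ x # r)" using ow p open_walk_suffix[of E Z l x] by simp
  have "m \<noteq> []"
  proof
    assume "m = []"
    then have "(x, x) \<in> E" using loop by (cases r) auto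
    then show False using irr by auto
  qed
  obtain y m1 where m1: "m = y # m1" using \<open>m \<noteq> []\<close> by (cases m) auto
  obtain y' m2 where m2: "m = m2 @ [y']" using \<open>m \<noteq> []\<close> by (cases m rule: rev_cases) auto
  have "open_walk E Z (l @ x # r)"
  proof (cases l rule: rev_cases)
    case Nil
    then show ?thesis using open_walk_suffix[of E Z "x # m" x r] loop by simp
  next
    case (snoc l' t)
    show ?thesis
    proof (cases r)
      case Nil
      then show ?thesis using ow p open_walk_prefix[of E Z l x] by simp
    next
      case (Cons w r')
      have left: "open_walk E Z (l' @ [t, x])" "open_walk E Z (t # x # y # m1 @ x # r)"
        using ow p snoc m1 open_walk_join[of E Z l' t x "m @ x # r"] by auto
      have "open_walk E Z ((x # m2) @ y' # x # w # r')"
        using loop m2 Cons by simp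
      then have right: "open_walk E Z (y' # x # w # r')"
        using open_walk_join[of E Z "x # m2" y' x "w # r'"] by simp
      have "passes E Z t x w"
      proof (cases "(t, x) \<in> E \<and> (w, x) \<in> E")
        case True
        have "x \<in> anc E Z" if "(x, y) \<in> E"
        proof -
          have "open_walk E Z (x # y # m1 @ [x])"
            using open_walk_prefix[of E Z "x # m" x r] loop m1 by simp
          then show ?thesis using open_walk_forward that irr by fastforce
        qed
        moreover have "(x, y) \<in> E \<or> (y, x) \<in> E" using loop m1 by (cases m1) auto
        ultimately show ?thesis using True left(2) by (auto simp: passes_def)
      next
        case False
        then show ?thesis using left(2) right by (auto simp: passes_def split: if_splits)
      qed
      then have "open_walk E Z (t # x # w # r')"
        using left(2) right by (cases r') auto
      then show ?thesis using left(1) snoc Cons open_walk_join[of E Z l' t x r] by simp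
    qed
  qed
  then have "length p \<le> length (l @ x # r)"
    using assms(2) p unfolding shortest_open_walk_def
    by (metis append_Cons append_is_Nil_conv append_self_conv2 hd_append2 last.simps last_append list.distinct(1) list.sel(1))
  then show False using p \<open>m \<noteq> []\<close> by simp
qed

lemma open_walk_shortcut:
  assumes "open_walk E Z (l @ u # v # w # r)" "(u, w) \<in> E \<union> E\<inverse>"
    and "l \<noteq> [] \<Longrightarrow> passes E Z (last l) u v \<Longrightarrow> passes E Z (last l) u w"
    and "r \<noteq> [] \<Longrightarrow> passes E Z v w (hd r) \<Longrightarrow> passes E Z u w (hd r)"
  shows "open_walk E Z (l @ u # w # r)"
proof -
  have "open_walk E Z (u # v # w # r)" using open_walk_suffix[OF assms(1)] .
  then have right: "open_walk E Z (u # w # r)" using assms(2,4) by (cases r; cases "tl r") auto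
  show ?thesis
  proof (cases l rule: rev_cases)
    case Nil
    then show ?thesis using right by simp
  next
    case (snoc l' t)
    have "open_walk E Z (l' @ [t, u])" "open_walk E Z (t # u # v # w # r)"
      using assms(1) snoc open_walk_join[of E Z l' t u "v # w # r"] by auto
    then show ?thesis
      using right assms(3) snoc open_walk_join[of E Z l' t u "w # r"] by simp
  qed
qed

text \<open>
  In a shortest open walk no triple with adjacent outer nodes can be replaced by the edge between
  them, so the status of one of the outer nodes must change for the worse.
\<close>

lemma no_shortcut:
  assumes "shortest_open_walk E Z (l @ u # v # w # r)" "(u, w) \<in> E \<union> E\<inverse>"
    and "l \<noteq> [] \<Longrightarrow> passes E Z (last l) u v \<Longrightarrow> passes E Z (last l) u w"
    and "r \<noteq> [] \<Longrightarrow> passes E Z v w (hd r) \<Longrightarrow> passes E Z u w (hd r)"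
  shows False
proof -
  have "open_walk E Z (l @ u # w # r)"
    using assms open_walk_shortcut by (metis shortest_open_walk_def)
  moreover have "hd (l @ u # w # r) = hd (l @ u # v # w # r)" by (cases l) auto
  moreover have "last (l @ u # w # r) = last (l @ u # v # w # r)" by simp
  ultimately have "length (l @ u # v # w # r) \<le> length (l @ u # w # r)"
    using assms(1) unfolding shortest_open_walk_def by blast
  then show False by simp
qed

lemma open_walk_triple:
  assumes "open_walk E Z (l @ u # v # w # r)"
  shows "(u, v) \<in> E \<union> E\<inverse>" "(v, w) \<in> E \<union> E\<inverse>" "passes E Z u v w"
    "l \<noteq> [] \<Longrightarrow> passes E Z (last l) u v" "r \<noteq> [] \<Longrightarrow> passes E Z v w (hd r)"
proof -
  have *: "open_walk E Z (u # v # w # r)" using open_walk_suffix[OF assms] .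
  then show "(u, v) \<in> E \<union> E\<inverse>" "(v, w) \<in> E \<union> E\<inverse>" "passes E Z u v w"
    by (cases r; auto)+
  show "r \<noteq> [] \<Longrightarrow> passes E Z v w (hd r)" using * by (cases r) auto
  assume "l \<noteq> []"
  then obtain l' t where "l = l' @ [t]" by (cases l rule: rev_cases) auto
  then show "passes E Z (last l) u v"
    using assms open_walk_join[of E Z l' t u "v # w # r"] by simp
qed

text \<open>
  For \<open>u \<rightarrow> v \<leftarrow> w\<close> and \<open>u \<rightarrow> w\<close>, dropping \<open>v\<close> keeps the open walk open: \<open>u\<close> stays a non-collider,
  and \<open>w\<close>, if it turns into a collider, inherits from \<open>v\<close> that it is an ancestor of \<open>Z\<close>.
\<close>

lemma shortest_no_shielded_collider_directed:
  assumes "acyclic E" "shortest_open_walk E Z (l @ u # v # w # r)"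
    and "(u, v) \<in> E" "(w, v) \<in> E" "(u, w) \<in> E"
  shows False
proof (rule no_shortcut[OF assms(2)])
  have ow: "open_walk E Z (l @ u # v # w # r)"
    using assms(2) by (simp add: shortest_open_walk_def)
  show "(u, w) \<in> E \<union> E\<inverse>" using assms by simp
  show "passes E Z (last l) u w" if "passes E Z (last l) u v"
    using that assms acyclic_asym[OF assms(1)] by (auto simp: passes_def)
  have "v \<in> anc E Z" using open_walk_triple(3)[OF ow] assms by (auto simp: passes_def)
  then have "w \<in> anc E Z" using assms anc_edge by metis
  then show "passes E Z u w (hd r)" if "passes E Z v w (hd r)"
    using that assms acyclic_asym[OF assms(1)] by (auto simp: passes_def)
qed

lemma shortest_no_shielded_collider:
  assumes "acyclic E" "shortest_open_walk E Z (l @ u # v # w # r)"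
    and "(u, v) \<in> E" "(w, v) \<in> E"
  shows "(u, w) \<notin> E \<union> E\<inverse>"
proof
  have "shortest_open_walk E Z (rev r @ w # v # u # rev l)"
    using shortest_open_walk_rev[OF assms(2)] by simp
  moreover assume "(u, w) \<in> E \<union> E\<inverse>"
  ultimately show False
    using assms shortest_no_shielded_collider_directed by (metis UnE converseD)
qed

text \<open>
  A directed path consists of non-colliders only, and these are outside \<open>Z\<close> when the first node
  is not an ancestor of \<open>Z\<close>.  So such a path is an open walk, and, reversed, it can be put in front
  of any open walk from \<open>k\<close>.
\<close>

lemma open_walk_from_ancestor:
  assumes "acyclic E" "(k, a) \<in> E\<^sup>*" "k \<notin> anc E Z"
  shows "\<exists>q. open_walk E Z (k # q) \<and> last (k # q) = a \<and> (q \<noteq> [] \<longrightarrow> (k, hd q) \<in> E)"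
  using assms(2,3)
proof (induction rule: converse_rtrancl_induct)
  case base
  show ?case by (rule exI[of _ "[]"]) simp
next
  case (step k m)
  then have m: "m \<notin> anc E Z" using anc_edge by metis
  then obtain q where q: "open_walk E Z (m # q)" "last (m # q) = a" "q \<noteq> [] \<longrightarrow> (m, hd q) \<in> E"
    using step by blast
  have "m \<notin> Z" using m subset_anc by metis
  then have "open_walk E Z (k # m # q)"
    using q(1,3) step(1) acyclic_asym[OF assms(1), of m "hd q"]
    by (cases q) (simp_all add: passes_def)
  moreover have "last (k # m # q) = a" "(k, hd (m # q)) \<in> E" using q(2) step(1) by simp_all
  ultimately show ?case by blast
qed

lemma open_walk_extend_descendant:
  assumes "acyclic E" "(k, b) \<in> E\<^sup>*" "k \<notin> anc E Z" "open_walk E Z (k # q)"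
  shows "\<exists>q'. open_walk E Z (b # q') \<and> last (b # q') = last (k # q)"
  using assms(2-4)
proof (induction arbitrary: q rule: converse_rtrancl_induct)
  case base
  then show ?case by blast
next
  case (step k m)
  then have m: "m \<notin> anc E Z" using anc_edge by metis
  have "k \<notin> Z" using step(4) subset_anc by metis
  then have "open_walk E Z (m # k # q)"
    using step(1,5) acyclic_asym[OF assms(1), of k m]
    by (cases q) (simp_all add: passes_def)
  from step(3)[OF m this] show ?case by simp
qed

definition family :: "('v \<times> 'v) set \<Rightarrow> 'v \<Rightarrow> 'v set" where
  "family E k = insert k {j. (j, k) \<in> E}"

text \<open>
  An open walk to \<open>a\<close> can be rerouted between members of a family, possibly through the child \<open>k\<close>.
  Trouble arises only if \<open>k\<close> becomes a collider that is not an ancestor of \<open>Z\<close>.  Then \<open>k\<close> is an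
  ancestor of \<open>a\<close>, and one may walk down from \<open>k\<close> to \<open>a\<close> directly, or it is an ancestor of \<open>b\<close>, and
  walking down to \<open>b\<close> would join \<open>a\<close> and \<open>b\<close>.
\<close>

lemma open_walk_reach_family:
  assumes "acyclic E" "k \<in> anc E ({a, b} \<union> Z)"
    and no_walk: "\<nexists>q. open_walk E Z (b # q) \<and> last (b # q) = a"
    and u: "u \<in> family E k" "u \<notin> Z" "open_walk E Z (u # q)" "last (u # q) = a"
    and v: "v \<in> family E k" "v \<notin> Z"
  shows "\<exists>q. open_walk E Z (v # q) \<and> last (v # q) = a"
proof -
  note asym = acyclic_asym[OF assms(1)]
  have "\<exists>q'. open_walk E Z (k # q') \<and> last (k # q') = a \<and> (u = k \<or> q' = u # q)"
  proof (cases "u = k")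
    case True
    then show ?thesis using u by blast
  next
    case False
    then have "(u, k) \<in> E" using u by (simp add: family_def)
    then have "open_walk E Z (k # u # q)"
      using u(2,3) asym[of u k] by (cases q) (simp_all add: passes_def)
    moreover have "last (k # u # q) = a" using u(4) by simp
    ultimately show ?thesis by blast
  qed
  then obtain q' where q': "open_walk E Z (k # q')" "last (k # q') = a" "u = k \<or> q' = u # q"
    by blast
  show ?thesis
  proof (cases "v = k")
    case True
    then show ?thesis using q' by blast
  next
    case False
    then have vk: "(v, k) \<in> E" using v by (simp add: family_def)
    consider "k \<in> anc E Z" | "k \<notin> anc E Z" "(k, a) \<in> E\<^sup>*" | "k \<notin> anc E Z" "(k, b) \<in> E\<^sup>*"
      using assms(2) by (auto simp: anc_def)
    then show ?thesis
    proof cases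
      case 1
      have "passes E Z v k x" if x: "q' = x # p" for x p
      proof (cases "(x, k) \<in> E")
        case True
        then show ?thesis using vk 1 by (simp add: passes_def)
      next
        case False
        then have "u = k" using q'(3) x u(1) by (auto simp: family_def)
        then show ?thesis using False u(2) by (simp add: passes_def)
      qed
      then have "open_walk E Z (v # k # q')"
        using q'(1) vk by (cases q') simp_all
      moreover have "last (v # k # q') = a" using q'(2) by simp
      ultimately show ?thesis by blast
    next
      case 2
      then obtain p where p: "open_walk E Z (k # p)" "last (k # p) = a" "p \<noteq> [] \<longrightarrow> (k, hd p) \<in> E"
        using open_walk_from_ancestor[OF assms(1)] by blast
      \<comment> \<open>The old walk is discarded; the new one leaves \<open>k\<close> along an arrow, so \<open>k\<close> is a non-collider.\<close>
      have "k \<notin> Z" using 2(1) subset_anc by metis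
      then have "open_walk E Z (v # k # p)"
        using p vk asym[of k "hd p"] by (cases p) (simp_all add: passes_def)
      moreover have "last (v # k # p) = a" using p(2) by simp
      ultimately show ?thesis by blast
    next
      case 3
      have "\<exists>q. open_walk E Z (b # q) \<and> last (b # q) = last (k # q')"
        using open_walk_extend_descendant[OF assms(1) 3(2,1) q'(1)] .
      then show ?thesis unfolding q'(2) using no_walk by blast
    qed
  qed
qed

section \<open>Open walks in a DAG and definite status paths in a maximal PDAG\<close>

locale representing_dag =
  fixes G D :: "'v graph"
  assumes maximal: "maximal_pdag G" and represented: "D \<in> represented_dags G"
begin

abbreviation "E \<equiv> dir D"

lemma acyclic_E: "acyclic E"
  and dir_G_E: "(u, v) \<in> dir G \<Longrightarrow> (u, v) \<in> E"
  and adj_G: "adj G = E \<union> E\<inverse>"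
  and adj_und: "(u, v) \<in> adj G \<Longrightarrow> (u, v) \<notin> dir G \<Longrightarrow> (v, u) \<notin> dir G \<Longrightarrow> (u, v) \<in> und G \<and> (v, u) \<in> und G"
  and v_structure: "(u, v) \<in> E \<Longrightarrow> (w, v) \<in> E \<Longrightarrow> u \<noteq> w \<Longrightarrow> (u, w) \<notin> adj G \<Longrightarrow>
     (u, v) \<in> dir G \<and> (w, v) \<in> dir G"
  and und_adj: "(u, v) \<in> und G \<Longrightarrow> (u, v) \<in> adj G \<and> (u, v) \<notin> dir G \<and> (v, u) \<notin> dir G"
  and no_forbidden_a: "(a, b) \<in> dir G \<Longrightarrow> (b, c) \<in> und G \<Longrightarrow> a \<noteq> c \<Longrightarrow> (a, c) \<in> adj G"
  and E_nodes: "(u, v) \<in> E \<Longrightarrow> u \<in> nodes G \<and> v \<in> nodes G"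
proof -
  have D: "dag D" "nodes D = nodes G" "adj D = adj G" "v_structures D = v_structures G"
    "dir G \<subseteq> E" using represented by (auto simp: represented_dags_def)
  have G: "pdag G" using maximal by (simp add: maximal_pdag_def)
  have symG: "sym (und G)" "dir G \<inter> und G = {}" using G by (auto simp: pdag_def simple_graph_def)
  show "acyclic E" using D by (simp add: dag_def pdag_def)
  show "(u, v) \<in> dir G \<Longrightarrow> (u, v) \<in> E" using D by auto
  show adjE: "adj G = E \<union> E\<inverse>" using D by (auto simp: dag_def adj_def)
  show "(u, v) \<in> adj G \<Longrightarrow> (u, v) \<notin> dir G \<Longrightarrow> (v, u) \<notin> dir G \<Longrightarrow> (u, v) \<in> und G \<and> (v, u) \<in> und G"
    using symG by (auto simp: adj_def sym_def)
  show "(u, v) \<in> E \<Longrightarrow> (w, v) \<in> E \<Longrightarrow> u \<noteq> w \<Longrightarrow> (u, w) \<notin> adj G \<Longrightarrow>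
     (u, v) \<in> dir G \<and> (w, v) \<in> dir G"
  proof -
    assume "(u, v) \<in> E" "(w, v) \<in> E" "u \<noteq> w" "(u, w) \<notin> adj G"
    then have "(u, v, w) \<in> v_structures D" using D(3) by (simp add: v_structures_def)
    then have "(u, v, w) \<in> v_structures G" using D(4) by simp
    then show ?thesis by (simp add: v_structures_def)
  qed
  show "(u, v) \<in> und G \<Longrightarrow> (u, v) \<in> adj G \<and> (u, v) \<notin> dir G \<and> (v, u) \<notin> dir G"
    using symG by (auto simp: adj_def sym_def)
  show "(a, b) \<in> dir G \<Longrightarrow> (b, c) \<in> und G \<Longrightarrow> a \<noteq> c \<Longrightarrow> (a, c) \<in> adj G"
    using maximal by (auto simp: maximal_pdag_def forbidden_a_def)
  show "(u, v) \<in> E \<Longrightarrow> u \<in> nodes G \<and> v \<in> nodes G"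
    using D by (auto simp: dag_def pdag_def simple_graph_def)
qed

lemma E_asym: "(u, v) \<in> E \<Longrightarrow> (v, u) \<notin> E"
  using acyclic_asym[OF acyclic_E] .

lemma E_shield: "(u, v) \<in> E \<Longrightarrow> (v, w) \<in> E \<Longrightarrow> (u, w) \<in> E \<union> E\<inverse> \<Longrightarrow> (u, w) \<in> E"
  by (metis E_asym UnE acyclic_E acyclic_def converse.cases r_into_trancl trancl_trans)

text \<open>
  If none of the first three alternatives holds and only one of the two edges is undirected, then
  the other one points into \<open>v\<close>, which is the excluded configuration \<open>A \<rightarrow> B - C\<close>.
\<close>

lemma unshielded_status:
  assumes "(u, v) \<in> adj G" "(v, w) \<in> adj G" "u \<noteq> w" "(u, w) \<notin> adj G"
  shows "((u, v) \<in> dir G \<and> (w, v) \<in> dir G) \<or> (v, u) \<in> dir G \<or> (v, w) \<in> dir G \<or>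
    ((u, v) \<in> und G \<and> (v, w) \<in> und G)"
proof -
  have sym: "(w, u) \<notin> adj G" using assms(4) adj_G by auto
  have vu: "(v, u) \<in> adj G" using assms(1) adj_G by auto
  show ?thesis
    using no_forbidden_a[of u v w] no_forbidden_a[of w v u] adj_und[OF assms(1)]
      adj_und[OF assms(2)] assms sym by blast
qed

text \<open>
  For \<open>u \<leftarrow> v \<rightarrow> w\<close> and \<open>u \<rightarrow> w\<close> the shortcut from \<open>u\<close> to \<open>w\<close> is blocked only if the walk enters \<open>u\<close> by
  an arrow \<open>t \<rightarrow> u\<close> and \<open>u \<in> Z\<close>.  If \<open>v \<rightarrow> u\<close> were undirected in \<open>G\<close>, then \<open>t \<rightarrow> u \<leftarrow> v\<close> would not be a
  v-structure, so that \<open>t\<close> and \<open>v\<close> would be adjacent, and \<open>u\<close> itself could be dropped: \<open>v\<close> remains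
  a non-collider, and \<open>t\<close>, if it turns into a collider, is an ancestor of \<open>u \<in> Z\<close>.
\<close>

lemma shielded_noncollider_fork:
  assumes "shortest_open_walk E Z (l @ u # v # w # r)"
    and "(v, u) \<in> E" "(v, w) \<in> E" "(u, w) \<in> E"
  shows "(v, u) \<in> dir G"
proof (rule ccontr)
  assume nd: "(v, u) \<notin> dir G"
  have ow: "open_walk E Z (l @ u # v # w # r)"
    using assms(1) by (simp add: shortest_open_walk_def)
  have dist: "distinct (l @ u # v # w # r)"
    using shortest_open_walk_distinct[OF acyclic_E assms(1)] .
  note tr = open_walk_triple[OF ow]
  have w: "passes E Z u w (hd r)" if "passes E Z v w (hd r)"
    using that assms by (auto simp: passes_def)
  show False
  proof (cases "l \<noteq> [] \<and> (last l, u) \<in> E \<and> u \<in> Z")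
    case False
    show False
    proof (rule no_shortcut[OF assms(1)])
      show "(u, w) \<in> E \<union> E\<inverse>" using assms by simp
      show "passes E Z (last l) u w" if "l \<noteq> []" "passes E Z (last l) u v"
        using that False assms(2,4) E_asym by (auto simp: passes_def)
    qed (use w in auto)
  next
    case True
    then obtain l' t where l: "l = l' @ [t]" by (cases l rule: rev_cases) auto
    then have t: "(t, u) \<in> E" "u \<in> Z" using True by auto
    have "(t, v) \<in> adj G" using v_structure[of t u v] t nd assms(2) dist l by auto
    then have tv: "(t, v) \<in> E \<union> E\<inverse>" using adj_G by simp
    have sh: "shortest_open_walk E Z (l' @ t # u # v # w # r)" using assms(1) l by simp
    have "t \<in> anc E Z" using t by (auto intro: anc_edge subset_anc)
    moreover have "(w, v) \<notin> E" using E_asym assms(3) by blast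
    moreover have "v \<notin> Z" using tr(3) \<open>(w, v) \<notin> E\<close> by (auto simp: passes_def)
    moreover have "t \<notin> Z" if "l' \<noteq> []"
    proof -
      have "open_walk E Z (l' @ t # u # v # w # r)" using ow l by simp
      then have "passes E Z (last l') t u" using open_walk_triple(4) that by metis
      then show ?thesis using E_asym[OF t(1)] by (simp add: passes_def)
    qed
    ultimately have "l' \<noteq> [] \<Longrightarrow> passes E Z (last l') t v" "passes E Z t v w"
      by (simp_all add: passes_def)
    then show False using no_shortcut[OF sh tv] by simp
  qed
qed

lemma shielded_noncollider_out:
  assumes "shortest_open_walk E Z (l @ u # v # w # r)"
    and "(v, w) \<in> E" "(u, w) \<in> adj G"
  shows "(v, u) \<in> dir G \<or> (v, w) \<in> dir G"
proof -
  have ow: "open_walk E Z (l @ u # v # w # r)"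
    using assms(1) by (simp add: shortest_open_walk_def)
  have uw: "(u, w) \<in> E \<union> E\<inverse>" using assms(3) adj_G by simp
  consider "(u, v) \<in> E" | "(v, u) \<in> E" "(u, w) \<in> E" | "(v, u) \<in> E" "(w, u) \<in> E"
    using open_walk_triple(1)[OF ow] uw by auto
  then show ?thesis
  proof cases
    case 1
    then have "(u, w) \<in> E" using E_shield assms(2) uw by blast
    then have False
      using no_shortcut[OF assms(1) uw] 1 assms(2) E_asym by (auto simp: passes_def)
    then show ?thesis ..
  next
    case 2
    then show ?thesis using shielded_noncollider_fork assms by blast
  next
    case 3
    have "shortest_open_walk E Z (rev r @ w # v # u # rev l)"
      using shortest_open_walk_rev[OF assms(1)] by simp
    then show ?thesis using shielded_noncollider_fork 3 assms by blast
  qed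
qed

lemma shortest_triple_status:
  assumes "shortest_open_walk E Z (l @ u # v # w # r)"
  shows "((u, v) \<in> dir G \<and> (w, v) \<in> dir G) \<or> (v, u) \<in> dir G \<or> (v, w) \<in> dir G \<or>
    ((u, v) \<in> und G \<and> (v, w) \<in> und G \<and> (u, w) \<notin> adj G)"
proof -
  have ow: "open_walk E Z (l @ u # v # w # r)"
    using assms by (simp add: shortest_open_walk_def)
  have dist: "distinct (l @ u # v # w # r)"
    using shortest_open_walk_distinct[OF acyclic_E assms] .
  have a: "(u, v) \<in> adj G" "(v, w) \<in> adj G" using open_walk_triple(1,2)[OF ow] adj_G by auto
  show ?thesis
  proof (cases "(u, w) \<in> adj G")
    case False
    then show ?thesis using unshielded_status a dist by auto
  next
    case True
    have rev: "shortest_open_walk E Z (rev r @ w # v # u # rev l)"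
      using shortest_open_walk_rev[OF assms] by simp
    have wu: "(w, u) \<in> adj G" using True adj_G by auto
    have "\<not> ((u, v) \<in> E \<and> (w, v) \<in> E)"
      using shortest_no_shielded_collider[OF acyclic_E assms] True adj_G by auto
    then have "(v, w) \<in> E \<or> (v, u) \<in> E" using a adj_G by auto
    then show ?thesis
      using shielded_noncollider_out[OF assms _ True] shielded_noncollider_out[OF rev _ wu] by blast
  qed
qed

text \<open>
  The length of a shortest directed path to \<open>Z\<close>; it is meaningful for ancestors of \<open>Z\<close> only, and
  an unspecified constant for the other nodes.
\<close>

definition depth :: "'v set \<Rightarrow> 'v \<Rightarrow> nat" where
  "depth Z v = (LEAST n. \<exists>z\<in>Z. (v, z) \<in> E ^^ n)"

lemma depth_le: "z \<in> Z \<Longrightarrow> (v, z) \<in> E ^^ n \<Longrightarrow> depth Z v \<le> n"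
  unfolding depth_def by (rule Least_le) auto

lemma depth_attained: "v \<in> anc E Z \<Longrightarrow> \<exists>z\<in>Z. (v, z) \<in> E ^^ depth Z v"
proof -
  assume "v \<in> anc E Z"
  then obtain n where "\<exists>z\<in>Z. (v, z) \<in> E ^^ n" by (auto simp: anc_def rtrancl_power)
  then show ?thesis unfolding depth_def by (rule LeastI)
qed

lemma depth_edge: "(u, v) \<in> E \<Longrightarrow> v \<in> anc E Z \<Longrightarrow> depth Z u \<le> Suc (depth Z v)"
  using depth_attained[of v Z] depth_le relpow_Suc_I2[of u v E] by blast

lemma depth_step:
  assumes "v \<in> anc E Z" "v \<notin> Z"
  obtains w where "(v, w) \<in> E" "w \<in> anc E Z" "depth Z v = Suc (depth Z w)"
proof -
  obtain z where z: "z \<in> Z" "(v, z) \<in> E ^^ depth Z v" using depth_attained[OF assms(1)] by auto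
  have "depth Z v \<noteq> 0"
  proof
    assume "depth Z v = 0"
    then show False using z assms(2) by simp
  qed
  then obtain n where n: "depth Z v = Suc n" using not0_implies_Suc by blast
  then obtain w where w: "(v, w) \<in> E" "(w, z) \<in> E ^^ n" using z(2) relpow_Suc_D2 by metis
  have wa: "w \<in> anc E Z" using w z by (auto simp: anc_def intro: relpow_imp_rtrancl)
  have "depth Z w \<le> n" using depth_le z w by blast
  then have "depth Z v = Suc (depth Z w)" using depth_edge[OF w(1) wa] n by simp
  then show thesis using that w wa by blast
qed

text \<open>
  Along a shortest directed path of \<open>D\<close> to \<open>Z\<close> directedness in \<open>G\<close> propagates.  If \<open>u \<rightarrow> v\<close> is in
  \<open>G\<close> and the next edge \<open>v - w\<close> is undirected in \<open>G\<close>, then \<open>u\<close> and \<open>w\<close> are adjacent, and \<open>u \<rightarrow> w\<close>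
  shortens the path.
\<close>

lemma shortest_descent_directed:
  assumes "(u, v) \<in> dir G" "v \<in> anc E Z" "depth Z u = Suc (depth Z v)"
  shows "v \<in> anc (dir G) Z"
  using assms
proof (induction "depth Z v" arbitrary: u v)
  case 0
  then have "v \<in> Z" using depth_attained[of v Z] by auto
  then show ?case by (rule subset_anc)
next
  case (Suc n)
  show ?case
  proof (cases "v \<in> Z")
    case True
    then show ?thesis by (rule subset_anc)
  next
    case False
    then obtain w where w: "(v, w) \<in> E" "w \<in> anc E Z" "depth Z v = Suc (depth Z w)"
      using depth_step Suc.prems by blast
    have "(v, w) \<in> dir G"
    proof (rule ccontr)
      assume "(v, w) \<notin> dir G"
      moreover have "(w, v) \<notin> dir G" using w dir_G_E E_asym by blast
      ultimately have "(v, w) \<in> und G" using w adj_G adj_und by blast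
      moreover have "u \<noteq> w" using w Suc.prems by auto
      ultimately have "(u, w) \<in> adj G" using no_forbidden_a Suc.prems by blast
      then have "(u, w) \<in> E" using E_shield dir_G_E Suc.prems(1) w adj_G by blast
      then show False using depth_edge w Suc.prems by fastforce
    qed
    then have "w \<in> anc (dir G) Z" using Suc.hyps w by auto
    then show ?thesis using \<open>(v, w) \<in> dir G\<close> anc_edge by metis
  qed
qed

text \<open>
  The collider \<open>c\<close> is part of a v-structure \<open>u \<rightarrow> c \<leftarrow> w\<close> of \<open>G\<close>.  As \<open>c - d\<close> is undirected in \<open>G\<close>,
  both \<open>u\<close> and \<open>w\<close> are adjacent to \<open>d\<close>, and acyclicity orients these edges towards \<open>d\<close> in \<open>D\<close>.
\<close>

lemma collider_lower:
  assumes "shortest_open_walk E Z (l @ u # c # w # r)"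
    and "(u, c) \<in> E" "(w, c) \<in> E" "(c, d) \<in> E" "(c, d) \<notin> dir G" "d \<in> anc E Z"
  shows "open_walk E Z (l @ u # d # w # r)"
proof -
  have ow: "open_walk E Z (l @ u # c # w # r)"
    using assms(1) by (simp add: shortest_open_walk_def)
  have dist: "distinct (l @ u # c # w # r)"
    using shortest_open_walk_distinct[OF acyclic_E assms(1)] .
  have "(u, w) \<notin> adj G" "u \<noteq> w"
    using shortest_no_shielded_collider[OF acyclic_E assms(1)] assms adj_G dist by auto
  then have dirs: "(u, c) \<in> dir G" "(w, c) \<in> dir G" using v_structure assms by blast+
  have und: "(c, d) \<in> und G" using adj_und assms dir_G_E E_asym adj_G by blast
  have "u \<noteq> d" "w \<noteq> d" using assms E_asym by auto
  then have "(u, d) \<in> E" "(w, d) \<in> E"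
    using no_forbidden_a[OF _ und] dirs adj_G E_shield assms(2-4) by blast+
  note e = this E_asym[OF this(1)] E_asym[OF this(2)] E_asym[OF assms(2)] E_asym[OF assms(3)]
  have w: "passes E Z d w (hd r)" if "r \<noteq> []"
    using open_walk_triple(5)[OF ow that] e by (auto simp: passes_def)
  have u: "passes E Z (last l) u d" if "l \<noteq> []"
    using open_walk_triple(4)[OF ow that] e by (auto simp: passes_def)
  have d: "passes E Z u d w" using assms(6) e by (simp add: passes_def)
  have "open_walk E Z (u # c # w # r)" using open_walk_suffix[OF ow] .
  then have right: "open_walk E Z (u # d # w # r)" using w d e by (cases r; cases "tl r") auto
  show ?thesis
  proof (cases l rule: rev_cases)
    case Nil
    then show ?thesis using right by simp
  next
    case (snoc l' t)
    then show ?thesis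
      using ow right u open_walk_join[of E Z l' t u "c # w # r"]
        open_walk_join[of E Z l' t u "d # w # r"] by simp
  qed
qed

lemma least_open_walk:
  assumes "open_walk E Z q"
  obtains p where "shortest_open_walk E Z p" "hd p = hd q" "last p = last q"
    and "\<And>p'. open_walk E Z p' \<Longrightarrow> hd p' = hd q \<Longrightarrow> last p' = last q \<Longrightarrow> length p' = length p \<Longrightarrow>
      sum_list (map (depth Z) p) \<le> sum_list (map (depth Z) p')"
proof -
  define P where "P p \<longleftrightarrow> open_walk E Z p \<and> hd p = hd q \<and> last p = last q" for p
  have "P q" using assms by (simp add: P_def)
  then obtain p0 where p0: "P p0" "\<forall>p. P p \<longrightarrow> length p0 \<le> length p"
    using ex_has_least_nat[of P q length] by auto
  then obtain p where p: "P p" "length p = length p0"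
    "\<forall>p'. P p' \<and> length p' = length p0 \<longrightarrow> sum_list (map (depth Z) p) \<le> sum_list (map (depth Z) p')"
    using ex_has_least_nat[of "\<lambda>p. P p \<and> length p = length p0" p0 "\<lambda>p. sum_list (map (depth Z) p)"]
    by auto
  show thesis
  proof (rule that)
    show "shortest_open_walk E Z p" "hd p = hd q" "last p = last q"
      using p p0 by (auto simp: P_def shortest_open_walk_def)
    show "\<And>p'. open_walk E Z p' \<Longrightarrow> hd p' = hd q \<Longrightarrow> last p' = last q \<Longrightarrow> length p' = length p \<Longrightarrow>
      sum_list (map (depth Z) p) \<le> sum_list (map (depth Z) p')"
      using p by (auto simp: P_def)
  qed
qed

text \<open>
  A directed walk repeats no node, for otherwise \<open>D\<close> would have a directed cycle.
\<close>

lemma causal_path_exists: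
  assumes "(c, z) \<in> (dir G)\<^sup>*" "z \<in> nodes G"
  shows "z \<in> de G {c}"
proof -
  have "\<exists>p. path_between G {c} {z} p \<and> causal G p \<and> (\<forall>v\<in>set p. (c, v) \<in> (dir G)\<^sup>*)"
    using assms(1)
  proof (induction rule: converse_rtrancl_induct)
    case base
    show ?case
      by (rule exI[of _ "[z]"]) (auto simp: path_between_def is_path_def causal_def assms)
  next
    case (step x y)
    then obtain p where p: "path_between G {y} {z} p" "causal G p" "\<forall>v\<in>set p. (y, v) \<in> (dir G)\<^sup>*"
      by auto
    have ne: "p \<noteq> []" "p ! 0 = y" using p(1) by (auto simp: path_between_def is_path_def hd_conv_nth)
    have "x \<notin> set p"
    proof
      assume "x \<in> set p"
      then have "(x, x) \<in> (dir G)\<^sup>+" using p(3) step(1) by (auto intro: rtrancl_into_trancl2)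
      then have "(x, x) \<in> E\<^sup>+" using dir_G_E by (meson subrelI trancl_mono)
      then show False using acyclic_E by (auto simp: acyclic_def)
    qed
    then have "path_between G {x} {z} (x # p)" "causal G (x # p)"
      using p ne step(1) E_nodes[OF dir_G_E[OF step(1)]]
      by (auto simp: path_between_def is_path_def causal_def nth_Cons adj_def split: nat.splits)
    moreover have "\<forall>v\<in>set (x # p). (x, v) \<in> (dir G)\<^sup>*"
      using p(3) step(1) by (auto intro: converse_rtrancl_into_rtrancl)
    ultimately show ?case by blast
  qed
  then show ?thesis by (auto simp: de_def)
qed

lemma open_walk_nodes: "open_walk E Z p \<Longrightarrow> hd p \<in> nodes G \<Longrightarrow> set p \<subseteq> nodes G"
  by (induction E Z p rule: open_walk.induct) (use E_nodes in auto)

lemma d_separated_no_open_walk: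
  assumes "d_separated G A B Z" "A \<subseteq> nodes G" "Z \<subseteq> nodes G"
    and "open_walk E Z q" "hd q \<in> A" "last q \<in> B"
  shows False
proof -
  obtain p where p: "shortest_open_walk E Z p" "hd p = hd q" "last p = last q"
    and least: "\<And>p'. open_walk E Z p' \<Longrightarrow> hd p' = hd q \<Longrightarrow> last p' = last q \<Longrightarrow>
      length p' = length p \<Longrightarrow> sum_list (map (depth Z) p) \<le> sum_list (map (depth Z) p')"
    using least_open_walk[OF assms(4)] by metis
  have ow: "open_walk E Z p" using p by (simp add: shortest_open_walk_def)
  have split: "p = take i p @ p ! i # p ! Suc i # drop (Suc (Suc i)) p" if "Suc i < length p" for i
    using that by (metis Cons_nth_drop_Suc Suc_lessD append_take_drop_id)
  have split3: "p = take (i - 1) p @ p ! (i - 1) # p ! i # p ! Suc i # drop (Suc (Suc i)) p"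
    if "0 < i" "Suc i < length p" for i
    using split[of "i - 1"] that by (auto simp: Cons_nth_drop_Suc)
  have "is_path G p"
    unfolding is_path_def
  proof (intro conjI allI impI)
    show "p \<noteq> []" using ow by auto
    show "distinct p" using shortest_open_walk_distinct[OF acyclic_E p(1)] .
    show "set p \<subseteq> nodes G" using open_walk_nodes[OF ow] p assms by auto
    fix i assume "Suc i < length p"
    then have "open_walk E Z (p ! i # p ! Suc i # drop (Suc (Suc i)) p)"
      using split ow open_walk_suffix by metis
    then show "(p ! i, p ! Suc i) \<in> adj G"
      using adj_G by (cases "drop (Suc (Suc i)) p") auto
  qed
  then have "path_between G A B p" using p assms by (simp add: path_between_def)
  moreover have "definite_status G p"
    unfolding definite_status_def
  proof (intro allI impI)
    fix i assume i: "0 < i \<and> Suc i < length p"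
    show "collider_at G p i \<or> noncollider_at G p i"
      using shortest_triple_status split3[of i] p(1) i unfolding collider_at_def noncollider_at_def
      by metis
  qed
  moreover have "\<not> blocked G Z p"
  proof
    assume "blocked G Z p"
    then obtain i where i: "0 < i" "Suc i < length p"
      and b: "noncollider_at G p i \<and> p ! i \<in> Z \<or> collider_at G p i \<and> de G {p ! i} \<inter> Z = {}"
      by (auto simp: blocked_def)
    define l u c w r where d: "l = take (i - 1) p" "u = p ! (i - 1)" "c = p ! i"
      "w = p ! Suc i" "r = drop (Suc (Suc i)) p"
    have pl: "p = l @ u # c # w # r" using split3[OF i] d by simp
    have sh: "shortest_open_walk E Z (l @ u # c # w # r)" using p(1) pl by simp
    have pass: "passes E Z u c w" using open_walk_triple(3) ow pl by metis
    have "distinct p" using shortest_open_walk_distinct[OF acyclic_E p(1)] .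
    then have uw: "u \<noteq> w" using pl by (metis distinct_append distinct_length_2_or_more)
    show False
      using b
    proof
      assume n: "noncollider_at G p i \<and> p ! i \<in> Z"
      then have e: "(u, c) \<in> E" "(w, c) \<in> E"
        using pass d by (auto simp: passes_def split: if_splits)
      have "(c, u) \<in> dir G \<or> (c, w) \<in> dir G \<or> (u, c) \<in> und G \<and> (u, w) \<notin> adj G"
        using n d by (auto simp: noncollider_at_def)
      then have "(u, c) \<in> und G \<and> (u, w) \<notin> adj G" using e dir_G_E E_asym by blast
      then show False using v_structure[OF e uw] und_adj by blast
    next
      assume c: "collider_at G p i \<and> de G {p ! i} \<inter> Z = {}"
      then have dirs: "(u, c) \<in> dir G" "(w, c) \<in> dir G" using d by (auto simp: collider_at_def)
      then have e: "(u, c) \<in> E" "(w, c) \<in> E" using dir_G_E by auto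
      then have ca: "c \<in> anc E Z" using pass by (simp add: passes_def)
      have "c \<in> anc (dir G) Z"
      proof (cases "c \<in> Z")
        case True
        then show ?thesis by (rule subset_anc)
      next
        case False
        then obtain b where bb: "(c, b) \<in> E" "b \<in> anc E Z" "depth Z c = Suc (depth Z b)"
          using depth_step[OF ca] by blast
        have "(c, b) \<in> dir G"
        proof (rule ccontr)
          assume "(c, b) \<notin> dir G"
          \<comment> \<open>Replacing \<open>c\<close> by \<open>b\<close> would keep the length and decrease the total distance to \<open>Z\<close>.\<close>
          then have "open_walk E Z (l @ u # b # w # r)" using collider_lower[OF sh e] bb by blast
          moreover have "hd (l @ u # b # w # r) = hd q" using p(2) pl by (cases l) auto
          moreover have "last (l @ u # b # w # r) = last q" using p(3) pl by auto
          moreover have "length (l @ u # b # w # r) = length p" using pl by simp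
          ultimately have "sum_list (map (depth Z) p) \<le> sum_list (map (depth Z) (l @ u # b # w # r))"
            by (rule least)
          then show False using pl bb(3) by simp
        qed
        then show ?thesis using shortest_descent_directed[of c b Z] bb anc_edge by metis
      qed
      then obtain z where "z \<in> Z" "(c, z) \<in> (dir G)\<^sup>*" by (auto simp: anc_def)
      then show False using causal_path_exists c d assms(3) by blast
    qed
  qed
  ultimately show False using assms(1) by (auto simp: d_separated_def)
qed

end

section \<open>Linear regression in a positive definite form\<close>

definition unit_vec :: "'v \<Rightarrow> 'v \<Rightarrow> real" where
  "unit_vec a i = (if i = a then 1 else 0)"

lemma unit_same [simp]: "unit_vec a a = 1"
  by (simp add: unit_vec_def)

lemma sum_unit: "finite K \<Longrightarrow> a \<in> K \<Longrightarrow> (\<Sum>k\<in>K. unit_vec a k * g k) = g a"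
proof -
  assume "finite K" "a \<in> K"
  moreover have "(\<Sum>k\<in>K. unit_vec a k * g k) = (\<Sum>k\<in>K. if k = a then g k else 0)"
    by (intro sum.cong) (auto simp: unit_vec_def)
  ultimately show ?thesis by simp
qed

text \<open>
  Vectors are coefficient functions, read on \<open>N\<close>; \<open>u\<close> stands for the linear combination of the
  centred variables with coefficients \<open>u\<close>, so that \<open>form\<close> below is the covariance of two such
  combinations.
\<close>

locale covariance_form =
  fixes N :: "'v set" and c :: "'v \<Rightarrow> 'v \<Rightarrow> real"
  assumes finite_N: "finite N"
    and symmetric: "i \<in> N \<Longrightarrow> j \<in> N \<Longrightarrow> c i j = c j i"
    and definite: "(\<Sum>i\<in>N. \<Sum>j\<in>N. u i * u j * c i j) \<le> 0 \<Longrightarrow> i \<in> N \<Longrightarrow> u i = 0"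
begin

definition form :: "('v \<Rightarrow> real) \<Rightarrow> ('v \<Rightarrow> real) \<Rightarrow> real" where
  "form u v = (\<Sum>i\<in>N. \<Sum>j\<in>N. u i * v j * c i j)"

lemma form_sym: "form u v = form v u"
  unfolding form_def
  by (subst sum.swap) (auto intro!: sum.cong simp: symmetric mult.commute)

lemma form_unit: "b \<in> N \<Longrightarrow> form u (unit_vec b) = (\<Sum>i\<in>N. u i * c i b)"
proof -
  assume b: "b \<in> N"
  have "form u (unit_vec b) = (\<Sum>i\<in>N. u i * (\<Sum>j\<in>N. unit_vec b j * c i j))"
    by (simp add: form_def sum_distrib_left mult.assoc)
  then show ?thesis using sum_unit[OF finite_N b] by simp
qed

lemma form_unit_unit: "a \<in> N \<Longrightarrow> b \<in> N \<Longrightarrow> form (unit_vec a) (unit_vec b) = c a b"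
  by (simp add: form_unit sum_unit[OF finite_N])

lemma form_expand: "form u v = (\<Sum>j\<in>N. v j * form u (unit_vec j))"
proof -
  have "form u v = (\<Sum>j\<in>N. \<Sum>i\<in>N. u i * v j * c i j)"
    unfolding form_def by (rule sum.swap)
  also have "\<dots> = (\<Sum>j\<in>N. v j * form u (unit_vec j))"
    by (intro sum.cong) (auto simp: form_unit sum_distrib_left mult_ac)
  finally show ?thesis .
qed

lemma form_diff_left: "form (\<lambda>i. u i - w i) v = form u v - form w v"
  by (simp add: form_def algebra_simps sum_subtractf)

lemma form_diff_right: "form v (\<lambda>i. u i - w i) = form v u - form v w"
  by (simp add: form_sym[of v] form_diff_left)

lemma form_scale_left: "form (\<lambda>i. t * u i) v = t * form u v"
  by (simp add: form_def sum_distrib_left mult_ac)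

lemma form_sum_left: "form (\<lambda>i. \<Sum>k\<in>K. w k i) v = (\<Sum>k\<in>K. form (w k) v)"
proof -
  have "form (\<lambda>i. \<Sum>k\<in>K. w k i) v = form v (\<lambda>i. \<Sum>k\<in>K. w k i)" by (rule form_sym)
  also have "\<dots> = (\<Sum>j\<in>N. \<Sum>k\<in>K. w k j * form v (unit_vec j))"
    by (subst form_expand) (simp add: sum_distrib_right)
  also have "\<dots> = (\<Sum>k\<in>K. form v (w k))"
    by (subst sum.swap) (simp add: form_expand[of v "w _"])
  finally show ?thesis by (simp add: form_sym)
qed

lemma form_pos: "i \<in> N \<Longrightarrow> u i \<noteq> 0 \<Longrightarrow> 0 < form u u"
  using definite[of u i] unfolding form_def by linarith

lemma form_nonneg: "0 \<le> form u u"
proof (cases "\<exists>i\<in>N. u i \<noteq> 0")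
  case True
  then show ?thesis using form_pos by (meson less_imp_le)
next
  case False
  then show ?thesis by (simp add: form_def)
qed

lemma form_zero: "form u u = 0 \<Longrightarrow> i \<in> N \<Longrightarrow> u i = 0"
  using form_pos by (metis less_irrefl)

lemma form_orthogonal:
  assumes "\<And>t. t \<in> T \<Longrightarrow> form r (unit_vec t) = 0" "\<And>i. i \<in> N \<Longrightarrow> i \<notin> T \<Longrightarrow> v i = 0"
  shows "form r v = 0"
  using assms by (subst form_expand) (metis (no_types, lifting) mult_eq_0_iff sum.neutral)

text \<open>
  The residual of \<open>a\<close> after regression on \<open>T\<close>: a vector that differs from \<open>a\<close> by a combination of
  \<open>T\<close> and is orthogonal to \<open>T\<close>.
\<close>

definition residual :: "'v set \<Rightarrow> 'v \<Rightarrow> ('v \<Rightarrow> real) \<Rightarrow> bool" where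
  "residual T a r \<longleftrightarrow>
     (\<forall>i. i \<notin> T \<longrightarrow> r i = unit_vec a i) \<and> (\<forall>t\<in>T. form r (unit_vec t) = 0)"

lemma residual_form_unit:
  assumes "residual T a r" "\<And>t. t \<in> T \<Longrightarrow> form s (unit_vec t) = 0"
  shows "form s (unit_vec a) = form s r"
proof -
  have "form s (\<lambda>i. unit_vec a i - r i) = 0"
    by (rule form_orthogonal[of T]) (use assms in \<open>auto simp: residual_def\<close>)
  then show ?thesis by (simp add: form_diff_right)
qed

text \<open>
  Gram--Schmidt: to add the regressor \<open>t\<close>, subtract from the residual of \<open>a\<close> its projection on the
  residual of \<open>t\<close>, which is non-zero as its coefficient at \<open>t\<close> is one.
\<close>

lemma residual_exists:
  assumes "T \<subseteq> N"
  shows "\<exists>r. residual T a r"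
proof -
  have "finite T" using assms finite_N finite_subset by blast
  then show ?thesis
    using assms
  proof (induction T arbitrary: a rule: finite_induct)
    case empty
    show ?case by (rule exI[of _ "unit_vec a"]) (simp add: residual_def)
  next
    case (insert t T)
    obtain r where r: "residual T a r" using insert by blast
    obtain s where s: "residual T t s" using insert by blast
    have "s t = 1" using s insert.hyps by (simp add: residual_def)
    then have pos: "0 < form s s" using form_pos insert.prems by auto
    define r' where "r' i = r i - form r s / form s s * s i" for i
    have form_r': "form r' v = form r v - form r s / form s s * form s v" for v
      using form_diff_left[of r "\<lambda>i. form r s / form s s * s i"]
      by (simp add: r'_def[abs_def] form_scale_left del: times_divide_eq_left)
    have T: "form r' (unit_vec j) = 0" if "j \<in> T" for j
      using that r s by (simp add: form_r' residual_def)
    have "form r' (unit_vec t) = form r' s" using residual_form_unit[OF s] T by blast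
    also have "\<dots> = 0" using pos by (simp add: form_r')
    finally have "residual (insert t T) a r'"
      using r s T by (auto simp: residual_def r'_def unit_vec_def)
    then show ?case by blast
  qed
qed

text \<open>
  The columns of the inverse are the rescaled residuals of each \<open>j \<in> T\<close> given \<open>T - {j}\<close>; they form
  the dual basis.  This is a right inverse; symmetry turns it into a left inverse.
\<close>

lemma nonsingular_subset:
  assumes "T \<subseteq> N"
  shows "nonsingular_on T c"
proof -
  have finT: "finite T" using assms finite_N finite_subset by blast
  have "\<exists>b. \<forall>i\<in>T. (\<Sum>k\<in>T. c i k * b k) = (if i = j then 1 else 0)" if j: "j \<in> T" for j
  proof -
    obtain r where r: "residual (T - {j}) j r" using residual_exists[of "T - {j}"] assms by blast
    have "r j = 1" using r by (simp add: residual_def)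
    then have pos: "0 < form r r" using form_pos j assms by auto
    have jj: "form r (unit_vec j) = form r r"
      using residual_form_unit[OF r] r by (simp add: residual_def)
    have eq: "(\<Sum>k\<in>T. c i k * (r k / form r r)) = form r (unit_vec i) / form r r" if "i \<in> T" for i
    proof -
      have "(\<Sum>k\<in>N. r k * c k i) = (\<Sum>k\<in>T. r k * c k i)"
        using assms finite_N r j by (intro sum.mono_neutral_right) (auto simp: residual_def unit_vec_def)
      also have "\<dots> = (\<Sum>k\<in>T. c i k * r k)"
        using that assms by (intro sum.cong refl) (metis mult.commute subsetD symmetric)
      finally show ?thesis
        using that assms by (auto simp: form_unit sum_divide_distrib)
    qed
    show ?thesis
      using eq jj pos r by (intro exI[of _ "\<lambda>k. r k / form r r"]) (auto simp: residual_def)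
  qed
  then obtain B where B: "\<And>i j. i \<in> T \<Longrightarrow> j \<in> T \<Longrightarrow> (\<Sum>k\<in>T. c i k * B j k) = (if i = j then 1 else 0)"
    by metis
  have cs: "c k l = c l k" if "k \<in> T" "l \<in> T" for k l
    using that assms symmetric by blast
  have symB: "B i j = B j i" if ij: "i \<in> T" "j \<in> T" for i j
  proof -
    have "B i j = (\<Sum>k\<in>T. unit_vec j k * B i k)" using ij finT by (simp add: sum_unit)
    also have "\<dots> = (\<Sum>k\<in>T. \<Sum>l\<in>T. c k l * B j l * B i k)"
      using B ij by (intro sum.cong refl) (simp add: unit_vec_def flip: sum_distrib_right)
    also have "\<dots> = (\<Sum>l\<in>T. \<Sum>k\<in>T. c l k * B i k * B j l)"
      by (subst sum.swap) (intro sum.cong refl, simp add: cs mult_ac)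
    also have "\<dots> = (\<Sum>l\<in>T. unit_vec i l * B j l)"
      using B ij by (intro sum.cong refl) (simp add: unit_vec_def flip: sum_distrib_right)
    also have "\<dots> = B j i" using ij finT by (simp add: sum_unit)
    finally show ?thesis .
  qed
  have "inverse_matrices_on T c (\<lambda>k j. B j k)"
    unfolding inverse_matrices_on_def
  proof (intro ballI conjI)
    fix i j assume ij: "i \<in> T" "j \<in> T"
    show "(\<Sum>k\<in>T. c i k * B j k) = (if i = j then 1 else 0)" using B ij .
    have "(\<Sum>k\<in>T. B k i * c k j) = (\<Sum>k\<in>T. c j k * B i k)"
      using ij assms symB symmetric by (intro sum.cong refl) (simp add: subset_iff)
    then show "(\<Sum>k\<in>T. B k i * c k j) = (if i = j then 1 else 0)" using B ij by auto
  qed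
  then show ?thesis by (auto simp: nonsingular_on_def)
qed

text \<open>
  The expression of \<open>cond_cov\<close> for an arbitrary form in place of the covariance.
\<close>

definition partial_cov :: "'v set \<Rightarrow> 'v \<Rightarrow> 'v \<Rightarrow> real" where
  "partial_cov T a b = c a b - (\<Sum>i\<in>T. \<Sum>j\<in>T. c a i * matrix_inv_on T c i j * c j b)"

text \<open>
  The normal equations identify the coefficients of the regression of \<open>a\<close> on \<open>T\<close> with the product
  of the row of \<open>a\<close> and the inverse matrix.
\<close>

lemma partial_cov_residual:
  assumes "T \<subseteq> N" "a \<in> N" "b \<in> N" "residual T a r"
  shows "partial_cov T a b = form r (unit_vec b)"
proof -
  define B where "B = matrix_inv_on T c"
  define \<beta> where "\<beta> i = unit_vec a i - r i" for i
  have finT: "finite T" using assms finite_N finite_subset by blast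
  have inv: "inverse_matrices_on T c B"
    using nonsingular_subset[OF assms(1)] unfolding nonsingular_on_def B_def matrix_inv_on_def
    by (rule someI_ex)
  have form_\<beta>: "form \<beta> (unit_vec i) = (\<Sum>k\<in>T. \<beta> k * c k i)" if "i \<in> N" for i
    unfolding form_unit[OF that]
    using assms finite_N by (intro sum.mono_neutral_right) (auto simp: residual_def \<beta>_def unit_vec_def)
  have \<beta>: "form \<beta> v = form (unit_vec a) v - form r v" for v
    unfolding \<beta>_def by (rule form_diff_left)
  have normal: "c a i = (\<Sum>k\<in>T. \<beta> k * c k i)" if "i \<in> T" for i
    using that assms form_\<beta>[of i] \<beta>[of "unit_vec i"] by (auto simp: residual_def form_unit_unit)
  have coeff: "(\<Sum>i\<in>T. c a i * B i j) = \<beta> j" if "j \<in> T" for j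
  proof -
    have "(\<Sum>i\<in>T. c a i * B i j) = (\<Sum>i\<in>T. \<Sum>k\<in>T. \<beta> k * (c k i * B i j))"
      by (intro sum.cong refl) (simp add: normal sum_distrib_right mult.assoc)
    also have "\<dots> = (\<Sum>k\<in>T. \<beta> k * (\<Sum>i\<in>T. c k i * B i j))"
      by (subst sum.swap) (simp add: sum_distrib_left)
    also have "\<dots> = (\<Sum>k\<in>T. unit_vec j k * \<beta> k)"
      using inv that by (intro sum.cong refl) (simp add: inverse_matrices_on_def unit_vec_def)
    also have "\<dots> = \<beta> j" using that finT by (simp add: sum_unit)
    finally show ?thesis .
  qed
  have "(\<Sum>i\<in>T. \<Sum>j\<in>T. c a i * B i j * c j b) = (\<Sum>j\<in>T. (\<Sum>i\<in>T. c a i * B i j) * c j b)"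
    by (subst sum.swap) (simp add: sum_distrib_right)
  also have "\<dots> = form \<beta> (unit_vec b)" using coeff form_\<beta> assms by simp
  finally show ?thesis
    using \<beta>[of "unit_vec b"] assms unfolding partial_cov_def B_def by (simp add: form_unit_unit)
qed

lemma partial_cov_variance:
  assumes "T \<subseteq> N" "a \<in> N" "residual T a r"
  shows "partial_cov T a a = form r r"
  using partial_cov_residual[OF assms(1,2,2,3)] residual_form_unit[OF assms(3)] assms(3)
  by (simp add: residual_def)

lemma partial_cov_variance_nonneg: "T \<subseteq> N \<Longrightarrow> a \<in> N \<Longrightarrow> 0 \<le> partial_cov T a a"
  using partial_cov_variance residual_exists form_nonneg by metis

lemma partial_cov_variance_pos:
  assumes "T \<subseteq> N" "a \<in> N" "a \<notin> T"
  shows "0 < partial_cov T a a"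
proof -
  obtain r where r: "residual T a r" using residual_exists assms by blast
  then have "r a = 1" using assms by (simp add: residual_def)
  then show ?thesis using partial_cov_variance form_pos assms r by (metis zero_neq_one)
qed

lemma partial_cov_sym:
  assumes "T \<subseteq> N" "a \<in> N" "b \<in> N"
  shows "partial_cov T a b = partial_cov T b a"
proof -
  obtain r s where rs: "residual T a r" "residual T b s" using residual_exists assms by metis
  have "form r (unit_vec b) = form r s" "form s (unit_vec a) = form s r"
    using residual_form_unit rs by (auto simp: residual_def)
  then show ?thesis using partial_cov_residual assms rs by (metis form_sym)
qed

text \<open>
  Pythagoras: the residual given \<open>U\<close> is orthogonal to its difference from the residual given \<open>T\<close>,
  since this difference is a combination of \<open>U\<close>.
\<close>

lemma partial_cov_variance_antimono:
  assumes "T \<subseteq> U" "U \<subseteq> N" "a \<in> N"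
  shows "partial_cov U a a \<le> partial_cov T a a"
proof -
  have T: "T \<subseteq> N" using assms by blast
  obtain r s where rs: "residual T a r" "residual U a s"
    using residual_exists T assms(2) by metis
  define d where "d i = r i - s i" for i
  have "form s d = 0"
    by (rule form_orthogonal[of U]) (use rs assms in \<open>auto simp: residual_def d_def subset_iff\<close>)
  moreover have "form s d = form r s - form s s"
    using form_sym[of s r] by (simp add: d_def[abs_def] form_diff_right)
  moreover have "form d d = form r r - form r s - form s d"
    by (simp add: d_def[abs_def] form_diff_left form_diff_right)
  ultimately have "form s s \<le> form r r"
    using form_nonneg[of d] by simp
  then show ?thesis using partial_cov_variance rs T assms by metis
qed

text \<open>
  A residual given \<open>T\<close> that is orthogonal to \<open>S\<close> is already the residual given \<open>T \<union> S\<close>.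
\<close>

lemma partial_cov_variance_irrelevant:
  assumes "T \<union> S \<subseteq> N" "a \<in> N" "\<And>s. s \<in> S \<Longrightarrow> partial_cov T a s = 0" "a \<notin> S"
  shows "partial_cov (T \<union> S) a a = partial_cov T a a"
proof -
  obtain r where r: "residual T a r" using residual_exists assms(1) by blast
  have "residual (T \<union> S) a r"
    using r assms partial_cov_residual[OF _ assms(2) _ r] by (auto simp: residual_def subset_iff)
  then show ?thesis using r partial_cov_variance assms by (metis le_sup_iff)
qed

text \<open>
  The residual of \<open>s\<close> given \<open>T\<close> is orthogonal to \<open>a\<close>, \<open>W\<close> and \<open>T\<close>, hence to the residual of \<open>a\<close>
  given \<open>W \<union> T\<close>, which is a combination of these.
\<close>

lemma partial_cov_weak_union:
  assumes "W \<union> T \<subseteq> N" "a \<in> N" "s \<in> N" "\<And>x. x \<in> insert a W \<Longrightarrow> partial_cov T x s = 0"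
  shows "partial_cov (W \<union> T) a s = 0"
proof -
  have N: "T \<subseteq> N" "W \<subseteq> N" using assms by auto
  obtain r q where rq: "residual (W \<union> T) a r" "residual T s q"
    using residual_exists N assms(1) by metis
  have orth: "form q (unit_vec x) = 0" if "x \<in> insert a W \<union> T" for x
  proof (cases "x \<in> T")
    case True
    then show ?thesis using rq by (simp add: residual_def)
  next
    case False
    then have "x \<in> N" "partial_cov T x s = 0" using that assms N by auto
    then show ?thesis using partial_cov_residual partial_cov_sym rq N assms by metis
  qed
  have "form r (unit_vec s) = form r q"
    using residual_form_unit[OF rq(2)] rq by (simp add: residual_def)
  also have "\<dots> = form q r" by (rule form_sym)
  also have "\<dots> = 0"
    by (rule form_orthogonal[of "insert a W \<union> T"]) (use orth rq in \<open>auto simp: residual_def unit_vec_def\<close>)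
  finally show ?thesis using partial_cov_residual rq assms by metis
qed

end

section \<open>Open walks and partial covariances in a linear structural equation model\<close>

locale linear_sem = covariance_form N c for N :: "'v set" and c +
  fixes E :: "('v \<times> 'v) set" and \<alpha> :: "'v \<Rightarrow> 'v \<Rightarrow> real"
  assumes E_N: "E \<subseteq> N \<times> N" and acyclic: "acyclic E"
    and uncorrelated: "\<And>k l. k \<in> N \<Longrightarrow> l \<in> N \<Longrightarrow> k \<noteq> l \<Longrightarrow>
      form (\<lambda>i. unit_vec k i - (if (i, k) \<in> E then \<alpha> k i else 0))
           (\<lambda>i. unit_vec l i - (if (i, l) \<in> E then \<alpha> l i else 0)) = 0"
begin

text \<open>
  The coefficient vector of the error of \<open>k\<close>, obtained by solving the structural equation of \<open>k\<close>
  for its error.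
\<close>

definition err :: "'v \<Rightarrow> 'v \<Rightarrow> real" where
  "err k i = unit_vec k i - (if (i, k) \<in> E then \<alpha> k i else 0)"

lemma err_uncorrelated: "k \<in> N \<Longrightarrow> l \<in> N \<Longrightarrow> k \<noteq> l \<Longrightarrow> form (err k) (err l) = 0"
  using uncorrelated by (simp add: err_def[abs_def])

lemma err_support: "i \<notin> family E k \<Longrightarrow> err k i = 0"
  by (auto simp: err_def family_def unit_vec_def)

lemma wf_E: "wf E"
  using acyclic E_N finite_N by (intro finite_acyclic_wf) (auto intro: finite_subset)

lemma err_variance_pos: "k \<in> N \<Longrightarrow> 0 < form (err k) (err k)"
proof (rule form_pos)
  show "err k k \<noteq> 0" using wf_E by (auto simp: err_def unit_vec_def)
qed

lemma orthogonal_to_errors: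
  assumes "A \<subseteq> N" "\<And>k. k \<in> A \<Longrightarrow> family E k \<subseteq> A"
    and "\<And>k. k \<in> A \<Longrightarrow> form u (err k) = 0" "k \<in> A"
  shows "form u (unit_vec k) = 0"
  using wf_E assms(4)
proof (induction k rule: wf_induct_rule)
  case (less k)
  let ?p = "\<lambda>i. if (i, k) \<in> E then \<alpha> k i else 0"
  have "form u ?p = 0"
    by (rule form_orthogonal[of "{j. (j, k) \<in> E}"]) (use less assms(2)[of k] in \<open>auto simp: family_def\<close>)
  moreover have "form u (err k) = form u (unit_vec k) - form u ?p"
    using form_diff_right[of u "unit_vec k" ?p] by (simp add: err_def[abs_def])
  ultimately show ?case using assms(3) less by simp
qed

text \<open>
  In a set that contains the parents of its members the errors are an orthogonal basis: the
  difference of the two sides is orthogonal to these errors, hence to all variables of the set,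
  of which it is a combination.
\<close>

lemma error_expansion:
  assumes "A \<subseteq> N" "\<And>k. k \<in> A \<Longrightarrow> family E k \<subseteq> A"
    and "\<And>i. i \<in> N \<Longrightarrow> i \<notin> A \<Longrightarrow> u i = 0" "i \<in> N"
  shows "u i = (\<Sum>k\<in>A. form u (err k) / form (err k) (err k) * err k i)"
proof -
  define w where "w k i = form u (err k) / form (err k) (err k) * err k i" for k i
  define d where "d i = u i - (\<Sum>k\<in>A. w k i)" for i
  have finA: "finite A" using assms(1) finite_N finite_subset by blast
  have form_w: "form (w k) v = form u (err k) / form (err k) (err k) * form (err k) v" for k v
    unfolding w_def[abs_def] by (rule form_scale_left)
  have "form d (err l) = 0" if "l \<in> A" for l
  proof -
    have "form (w k) (err l) = (if k = l then form u (err l) else 0)" if "k \<in> A" for k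
      using that \<open>l \<in> A\<close> assms(1) err_uncorrelated[of k l] err_variance_pos[of l]
      by (auto simp: form_w subset_iff)
    then show ?thesis
      using that finA by (simp add: d_def[abs_def] form_diff_left form_sum_left)
  qed
  then have "form d (unit_vec k) = 0" if "k \<in> A" for k
    using orthogonal_to_errors[OF assms(1,2)] that by blast
  moreover have "d i = 0" if "i \<in> N" "i \<notin> A" for i
  proof -
    have "err k i = 0" if "k \<in> A" for k
      using that \<open>i \<notin> A\<close> assms(2) by (intro err_support) blast
    then show ?thesis using that assms(3) by (simp add: d_def w_def)
  qed
  ultimately have "form d d = 0" by (rule form_orthogonal)
  then have "d i = 0" using form_zero assms(4) by blast
  then show ?thesis by (simp add: d_def w_def)
qed

text \<open>
  The linear form of the global Markov property.  The residual of \<open>a\<close> given \<open>A - R\<close> is orthogonal to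
  all variables outside \<open>R\<close>, so its expansion uses only errors whose family meets \<open>R\<close>; these
  families lie in \<open>R \<union> Z\<close>.
\<close>

theorem no_open_walk_partial_cov:
  assumes "Z \<subseteq> N" "a \<in> N" "b \<in> N" "a \<notin> Z"
    and no_walk: "\<nexists>q. open_walk E Z (b # q) \<and> last (b # q) = a"
  shows "partial_cov Z a b = 0"
proof -
  define A where "A = anc E ({a, b} \<union> Z)"
  define R where "R = {v \<in> A - Z. \<exists>q. open_walk E Z (v # q) \<and> last (v # q) = a}"
  have A_N: "A \<subseteq> N"
  proof
    fix v assume "v \<in> A"
    then obtain w where "(v, w) \<in> E\<^sup>*" "w \<in> N" using assms by (auto simp: A_def anc_def)
    then show "v \<in> N" using E_N by (metis converse_rtranclE mem_Sigma_iff subsetD)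
  qed
  have A_family: "family E k \<subseteq> A" if "k \<in> A" for k
    using that anc_edge[of _ k E "{a, b} \<union> Z"] by (auto simp: A_def family_def)
  have mem: "a \<in> A" "b \<in> A" "Z \<subseteq> A" by (auto simp: A_def intro: subset_anc)
  have "open_walk E Z (a # []) \<and> last (a # []) = a" by simp
  then have a_R: "a \<in> R" using mem assms unfolding R_def by blast
  have b_R: "b \<notin> R" using no_walk by (simp add: R_def)
  have family_R: "family E k \<subseteq> R \<union> Z" if k: "k \<in> A" and meets: "family E k \<inter> R \<noteq> {}" for k
  proof
    fix v assume v: "v \<in> family E k"
    obtain u q where u: "u \<in> family E k" "u \<notin> Z" "open_walk E Z (u # q)" "last (u # q) = a"
      using meets by (auto simp: R_def)
    have "v \<in> A" using v k A_family by blast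
    then show "v \<in> R \<union> Z"
      using open_walk_reach_family[OF acyclic k[unfolded A_def] no_walk u v] unfolding R_def by blast
  qed
  obtain r where r: "residual (A - R) a r" using residual_exists A_N by blast
  have r_A: "r i = 0" if "i \<in> N" "i \<notin> A" for i
    using that r mem by (auto simp: residual_def unit_vec_def)
  have "r i = 0" if i: "i \<in> A - R - Z" for i
  proof -
    have "form r (err k) / form (err k) (err k) * err k i = 0" if k: "k \<in> A" for k
    proof (cases "family E k \<inter> R = {}")
      case True
      have fam: "family E k \<subseteq> A - R" using True A_family[OF k] by blast
      have "form r (err k) = 0"
        by (rule form_orthogonal[of "A - R"])
          (use r fam err_support[of _ k] in \<open>auto simp: residual_def\<close>)
      then show ?thesis by simp
    next
      case False
      then have "i \<notin> family E k" using family_R[OF k] i by blast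
      then show ?thesis by (simp add: err_support)
    qed
    moreover have "i \<in> N" using i A_N by blast
    then have "r i = (\<Sum>k\<in>A. form r (err k) / form (err k) (err k) * err k i)"
      using error_expansion[where u = r and A = A] A_N A_family r_A by blast
    ultimately show ?thesis by (simp add: sum.neutral)
  qed
  moreover have "r i = unit_vec a i" if "i \<notin> A - R" for i
    using r that by (simp add: residual_def)
  moreover have "unit_vec a i = 0" if "i \<in> A - R - Z" for i
    using that a_R by (auto simp: unit_vec_def)
  ultimately have "r i = unit_vec a i" if "i \<notin> Z" for i
    using that by (cases "i \<in> A - R") auto
  moreover have "Z \<subseteq> A - R" using mem by (auto simp: R_def)
  ultimately have "residual Z a r"
    using r by (auto simp: residual_def)
  moreover have "form r (unit_vec b) = 0" using r mem b_R by (simp add: residual_def)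
  ultimately show ?thesis using partial_cov_residual assms by metis
qed

end

section \<open>Covariances of a causal linear model\<close>

definition square_integrable :: "'w measure \<Rightarrow> ('w \<Rightarrow> real) \<Rightarrow> bool" where
  "square_integrable M g \<longleftrightarrow> g \<in> borel_measurable M \<and> integrable M (\<lambda>\<omega>. (g \<omega>)\<^sup>2)"

lemma square_integrable_mult:
  assumes "square_integrable M g" "square_integrable M h"
  shows "integrable M (\<lambda>\<omega>. g \<omega> * h \<omega>)"
proof (rule Bochner_Integration.integrable_bound)
  show "integrable M (\<lambda>\<omega>. (g \<omega>)\<^sup>2 + (h \<omega>)\<^sup>2)"
    using assms by (auto simp: square_integrable_def)
  show "(\<lambda>\<omega>. g \<omega> * h \<omega>) \<in> borel_measurable M"
    using assms by (auto simp: square_integrable_def)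
  have "\<bar>x * y\<bar> \<le> x\<^sup>2 + y\<^sup>2" for x y :: real
  proof -
    have "0 \<le> (\<bar>x\<bar> - \<bar>y\<bar>)\<^sup>2" by simp
    then have "2 * \<bar>x * y\<bar> \<le> x\<^sup>2 + y\<^sup>2" by (simp add: power2_diff abs_mult)
    then show ?thesis by (smt (verit) abs_ge_zero)
  qed
  then show "AE \<omega> in M. norm (g \<omega> * h \<omega>) \<le> norm ((g \<omega>)\<^sup>2 + (h \<omega>)\<^sup>2)" by simp
qed

lemma square_integrable_add:
  assumes "square_integrable M g" "square_integrable M h"
  shows "square_integrable M (\<lambda>\<omega>. g \<omega> + h \<omega>)"
  using assms square_integrable_mult[OF assms]
  by (auto simp: square_integrable_def power2_sum mult.assoc)

lemma square_integrable_cmult: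
  "square_integrable M g \<Longrightarrow> square_integrable M (\<lambda>\<omega>. t * g \<omega>)"
  by (auto simp: square_integrable_def power_mult_distrib)

lemma square_integrable_sum:
  assumes "\<And>i. i \<in> I \<Longrightarrow> square_integrable M (g i)"
  shows "square_integrable M (\<lambda>\<omega>. \<Sum>i\<in>I. g i \<omega>)"
proof (cases "finite I")
  case True
  then show ?thesis
    using assms
    by (induction I rule: finite_induct) (simp_all add: square_integrable_add square_integrable_def[of _ "\<lambda>_. 0"])
next
  case False
  then show ?thesis by (simp add: square_integrable_def)
qed

lemma square_integrable_cong_AE:
  assumes "square_integrable M g" "h \<in> borel_measurable M" "AE \<omega> in M. h \<omega> = g \<omega>"
  shows "square_integrable M h"
proof -
  have "integrable M (\<lambda>\<omega>. (h \<omega>)\<^sup>2) \<longleftrightarrow> integrable M (\<lambda>\<omega>. (g \<omega>)\<^sup>2)"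
    using assms by (intro integrable_cong_AE) (auto simp: square_integrable_def)
  then show ?thesis using assms by (simp add: square_integrable_def)
qed

context prob_space
begin

definition centred :: "('v \<Rightarrow> 'a \<Rightarrow> real) \<Rightarrow> 'v \<Rightarrow> 'a \<Rightarrow> real" where
  "centred V i \<omega> = V i \<omega> - expectation (V i)"

lemma cov_centred: "cov M V a b = expectation (\<lambda>\<omega>. centred V a \<omega> * centred V b \<omega>)"
  by (simp add: cov_def centred_def)

lemma square_integrable_centred:
  assumes "square_integrable M (V i)"
  shows "square_integrable M (centred V i)"
  using square_integrable_add[OF assms, of "\<lambda>_. - expectation (V i)"]
  by (simp add: centred_def[abs_def] square_integrable_def)

lemma cov_form:
  assumes "\<And>i. i \<in> N \<Longrightarrow> square_integrable M (V i)"
  shows "(\<Sum>i\<in>N. \<Sum>j\<in>N. u i * v j * cov M V i j) =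
    expectation (\<lambda>\<omega>. (\<Sum>i\<in>N. u i * centred V i \<omega>) * (\<Sum>j\<in>N. v j * centred V j \<omega>))"
proof -
  have int: "integrable M (\<lambda>\<omega>. u i * centred V i \<omega> * (v j * centred V j \<omega>))"
    if "i \<in> N" "j \<in> N" for i j
    using that assms by (intro square_integrable_mult square_integrable_cmult square_integrable_centred)
  have "(\<Sum>i\<in>N. \<Sum>j\<in>N. u i * v j * cov M V i j) =
    (\<Sum>i\<in>N. \<Sum>j\<in>N. expectation (\<lambda>\<omega>. u i * centred V i \<omega> * (v j * centred V j \<omega>)))"
    by (simp add: cov_centred mult_ac flip: integral_mult_right_zero)
  also have "\<dots> = expectation (\<lambda>\<omega>. \<Sum>i\<in>N. \<Sum>j\<in>N. u i * centred V i \<omega> * (v j * centred V j \<omega>))"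
    using int by (simp add: Bochner_Integration.integral_sum)
  finally show ?thesis by (simp add: sum_product)
qed

text \<open>
  A combination of variance at most zero vanishes almost surely, so it is uncorrelated with every
  variable; as the covariance matrix is invertible, its coefficients vanish.
\<close>

lemma covariance_form_cov:
  assumes "finite N" "\<And>i. i \<in> N \<Longrightarrow> square_integrable M (V i)" "nonsingular_on N (cov M V)"
  shows "covariance_form N (cov M V)"
proof
  show "finite N" by fact
  show "cov M V i j = cov M V j i" for i j by (simp add: cov_def mult.commute)
  fix u :: "'b \<Rightarrow> real" and i
  assume le: "(\<Sum>i\<in>N. \<Sum>j\<in>N. u i * u j * cov M V i j) \<le> 0" and i: "i \<in> N"
  define s where "s \<omega> = (\<Sum>i\<in>N. u i * centred V i \<omega>)" for \<omega>
  have s: "square_integrable M s"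
    unfolding s_def[abs_def]
    using assms by (intro square_integrable_sum square_integrable_cmult square_integrable_centred)
  have "expectation (\<lambda>\<omega>. s \<omega> * s \<omega>) \<le> 0"
    using le cov_form[OF assms(2), where u = u and v = u] by (simp add: s_def)
  moreover have "0 \<le> expectation (\<lambda>\<omega>. s \<omega> * s \<omega>)" by simp
  ultimately have "expectation (\<lambda>\<omega>. s \<omega> * s \<omega>) = 0" by linarith
  then have s0: "AE \<omega> in M. s \<omega> = 0"
    using integral_nonneg_eq_0_iff_AE[OF square_integrable_mult[OF s s]] by simp
  have zero: "(\<Sum>i\<in>N. u i * cov M V i j) = 0" if j: "j \<in> N" for j
  proof -
    have "(\<Sum>i\<in>N. \<Sum>k\<in>N. u i * unit_vec j k * cov M V i k) =
      expectation (\<lambda>\<omega>. s \<omega> * (\<Sum>k\<in>N. unit_vec j k * centred V k \<omega>))"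
      using cov_form[OF assms(2), where u = u and v = "unit_vec j"] by (simp add: s_def)
    also have "\<dots> = expectation (\<lambda>\<omega>. s \<omega> * centred V j \<omega>)"
      using j by (simp add: sum_unit[OF assms(1)])
    also have "\<dots> = expectation (\<lambda>_. 0)"
      using s s0 square_integrable_centred[of V j] assms(2)[OF j]
      by (intro integral_cong_AE) (auto simp: square_integrable_def)
    finally have "(\<Sum>i\<in>N. u i * (\<Sum>k\<in>N. unit_vec j k * cov M V i k)) = 0"
      by (simp add: sum_distrib_left mult.assoc)
    then show ?thesis using j by (simp add: sum_unit[OF assms(1)])
  qed
  obtain B where B: "inverse_matrices_on N (cov M V) B"
    using assms(3) by (auto simp: nonsingular_on_def)
  have "u i = (\<Sum>k\<in>N. unit_vec i k * u k)" using i by (simp add: sum_unit[OF assms(1)])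
  also have "\<dots> = (\<Sum>k\<in>N. (\<Sum>j\<in>N. cov M V k j * B j i) * u k)"
    using B i by (intro sum.cong refl) (simp add: inverse_matrices_on_def unit_vec_def)
  also have "\<dots> = (\<Sum>j\<in>N. (\<Sum>k\<in>N. u k * cov M V k j) * B j i)"
    by (simp add: sum_distrib_left sum_distrib_right mult_ac) (rule sum.swap)
  also have "\<dots> = 0" using zero by simp
  finally show "u i = 0" .
qed

end

text \<open>
  The variables are square integrable by induction along the DAG.  The combination with the
  coefficients of the error of \<open>k\<close>, applied to the centred variables, is almost surely the error
  itself because errors have mean zero, and independent errors are uncorrelated.
\<close>

lemma linear_model_sem:
  assumes model: "linear_model_dag M \<nu> V f D" and D: "dag D"
    and nonsing: "nonsingular_on (nodes D) (cov M V)"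
  shows "\<exists>\<alpha>. linear_sem (nodes D) (cov M V) (dir D) \<alpha>"
proof -
  define N where "N = nodes D"
  interpret prob_space M using model by (simp add: linear_model_dag_def)
  obtain \<alpha> \<epsilon> where indep: "indep_vars (\<lambda>_. borel) \<epsilon> N"
    and \<epsilon>: "\<And>i. i \<in> N \<Longrightarrow> integrable M (\<epsilon> i)" "\<And>i. i \<in> N \<Longrightarrow> integrable M (\<lambda>\<omega>. (\<epsilon> i \<omega>)\<^sup>2)"
      "\<And>i. i \<in> N \<Longrightarrow> expectation (\<epsilon> i) = 0"
    and V: "\<And>i. i \<in> N \<Longrightarrow> AE \<omega> in M. V i \<omega> = (\<Sum>j\<in>pa D i. \<alpha> i j * V j \<omega>) + \<epsilon> i \<omega>"
    using model unfolding linear_model_dag_def N_def by blast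
  have meas: "V i \<in> borel_measurable M" if "i \<in> N" for i
    using model that by (simp add: linear_model_dag_def N_def)
  have fin: "finite N" and E: "dir D \<subseteq> N \<times> N" and acyclic: "acyclic (dir D)"
    using D by (auto simp: dag_def pdag_def simple_graph_def N_def)
  have wf: "wf (dir D)"
    using acyclic E fin by (intro finite_acyclic_wf) (auto intro: finite_subset)
  have pa_N: "pa D i \<subseteq> N" for i using E by (auto simp: pa_def)
  have sq: "square_integrable M (V i)" if "i \<in> N" for i
    using wf that
  proof (induction i rule: wf_induct_rule)
    case (less i)
    have "square_integrable M (V j)" if "j \<in> pa D i" for j
      using less.IH[of j] that pa_N by (auto simp: pa_def)
    then have "square_integrable M (\<lambda>\<omega>. (\<Sum>j\<in>pa D i. \<alpha> i j * V j \<omega>) + \<epsilon> i \<omega>)"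
      using \<epsilon> less.prems
      by (intro square_integrable_add square_integrable_sum square_integrable_cmult)
        (auto simp: square_integrable_def)
    then show ?case using square_integrable_cong_AE meas V less.prems by blast
  qed
  have int: "integrable M (V i)" if "i \<in> N" for i
    using sq[OF that] square_integrable_imp_integrable by (auto simp: square_integrable_def)
  let ?e = "\<lambda>k i. unit_vec k i - (if (i, k) \<in> dir D then \<alpha> k i else 0)"
  have err: "AE \<omega> in M. (\<Sum>i\<in>N. ?e k i * centred V i \<omega>) = \<epsilon> k \<omega>" if k: "k \<in> N" for k
  proof -
    have split: "(\<Sum>i\<in>N. ?e k i * g i) = g k - (\<Sum>j\<in>pa D k. \<alpha> k j * g j)" for g :: "_ \<Rightarrow> real"
    proof -
      have "(\<Sum>i\<in>N. (if (i, k) \<in> dir D then \<alpha> k i else 0) * g i) = (\<Sum>j\<in>pa D k. \<alpha> k j * g j)"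
        using fin pa_N by (intro sum.mono_neutral_cong_right) (auto simp: pa_def)
      then show ?thesis using fin k by (simp add: left_diff_distrib sum_subtractf sum_unit)
    qed
    have int_pa: "integrable M (\<lambda>\<omega>. \<Sum>j\<in>pa D k. \<alpha> k j * V j \<omega>)"
      using int pa_N by (intro Bochner_Integration.integrable_sum integrable_mult_right) auto
    have "expectation (V k) = expectation (\<lambda>\<omega>. (\<Sum>j\<in>pa D k. \<alpha> k j * V j \<omega>) + \<epsilon> k \<omega>)"
      using V[OF k] meas[OF k] int_pa \<epsilon>(1)[OF k]
      by (intro integral_cong_AE) (auto dest: borel_measurable_integrable)
    also have "\<dots> = (\<Sum>j\<in>pa D k. \<alpha> k j * expectation (V j))"
      using int_pa \<epsilon> k int pa_N by (simp add: Bochner_Integration.integral_sum subset_iff)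
    finally have "expectation (V k) - (\<Sum>j\<in>pa D k. \<alpha> k j * expectation (V j)) = 0" by simp
    then show ?thesis
      using V[OF k] unfolding split
      by (auto simp: centred_def right_diff_distrib sum_subtractf)
  qed
  interpret covariance_form N "cov M V"
    using covariance_form_cov[OF fin sq] nonsing by (simp add: N_def)
  have "linear_sem N (cov M V) (dir D) \<alpha>"
  proof
    show "dir D \<subseteq> N \<times> N" by fact
    show "acyclic (dir D)" by fact
    fix k l assume kl: "k \<in> N" "l \<in> N" "k \<noteq> l"
    have "form (?e k) (?e l) = expectation (\<lambda>\<omega>. (\<Sum>i\<in>N. ?e k i * centred V i \<omega>) *
        (\<Sum>i\<in>N. ?e l i * centred V i \<omega>))"
      unfolding form_def by (rule cov_form[OF sq])
    also have "\<dots> = expectation (\<lambda>\<omega>. \<epsilon> k \<omega> * \<epsilon> l \<omega>)"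
    proof (rule integral_cong_AE)
      show "AE \<omega> in M. (\<Sum>i\<in>N. ?e k i * centred V i \<omega>) * (\<Sum>i\<in>N. ?e l i * centred V i \<omega>) =
          \<epsilon> k \<omega> * \<epsilon> l \<omega>"
        using err[OF kl(1)] err[OF kl(2)] by eventually_elim simp
      have "centred V i \<in> borel_measurable M" if "i \<in> N" for i
        using square_integrable_centred[of V i, OF sq[OF that]] by (simp add: square_integrable_def)
      then show "(\<lambda>\<omega>. (\<Sum>i\<in>N. ?e k i * centred V i \<omega>) * (\<Sum>i\<in>N. ?e l i * centred V i \<omega>))
          \<in> borel_measurable M"
        by (intro borel_measurable_times borel_measurable_sum borel_measurable_const)
      show "(\<lambda>\<omega>. \<epsilon> k \<omega> * \<epsilon> l \<omega>) \<in> borel_measurable M"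
        using \<epsilon>(1) kl by (auto dest: borel_measurable_integrable)
    qed
    also have "\<dots> = expectation (\<lambda>\<omega>. \<Prod>i\<in>{k, l}. \<epsilon> i \<omega>)" using kl by simp
    also have "\<dots> = (\<Prod>i\<in>{k, l}. expectation (\<epsilon> i))"
      using kl \<epsilon> by (intro indep_vars_lebesgue_integral indep_vars_subset[OF indep]) auto
    also have "\<dots> = 0" using kl \<epsilon> by simp
    finally show "form (?e k) (?e l) = 0" .
  qed
  then show ?thesis by (auto simp: N_def)
qed

section \<open>Comparison of two adjustment sets\<close>

theorem theorem3p4:
  fixes G :: "'v graph"
    and M :: "'w measure"
    and \<nu> :: "'v \<Rightarrow> real measure"
    and V :: "'v \<Rightarrow> 'w \<Rightarrow> real"
    and f :: "'v set \<Rightarrow> ('v \<Rightarrow> real) \<Rightarrow> ('v \<Rightarrow> real) \<Rightarrow> ennreal"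
    and X Y Z1 Z2 T S :: "'v set"
  assumes "maximal_pdag G"
    and "X \<subseteq> nodes G" and "Y \<subseteq> nodes G" and "X \<inter> Y = {}"
    and "linear_model_pdag M \<nu> V f G"
    and "nonsingular_on (nodes G) (cov M V)"
    and "valid_adjustment_set G X Y Z1"
    and "valid_adjustment_set G X Y Z2"
    and "T = Z1 - Z2" and "S = Z2 - Z1"
    and "d_separated G Y T (X \<union> Z2)"
    and "d_separated G X S Z1"
  shows "\<forall>y\<in>Y. \<forall>x\<in>X. a_var M V X Z2 y x \<le> a_var M V X Z1 y x"
proof (intro ballI)
  fix y x assume y: "y \<in> Y" and x: "x \<in> X"
  obtain D where D: "D \<in> represented_dags G" and model: "linear_model_dag M \<nu> V f D"
    using assms(5) by (auto simp: linear_model_pdag_def)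
  then have dag: "dag D" "nodes D = nodes G" by (auto simp: represented_dags_def)
  interpret representing_dag G D by standard (fact assms(1) D)+
  obtain \<alpha> where "linear_sem (nodes G) (cov M V) E \<alpha>"
    using linear_model_sem[OF model dag(1)] assms(6) dag by auto
  then interpret linear_sem "nodes G" "cov M V" E \<alpha> .
  have Z: "Z1 \<subseteq> nodes G" "Z2 \<subseteq> nodes G" "Z1 \<inter> (X \<union> Y) = {}" "Z2 \<inter> (X \<union> Y) = {}"
    using assms(7,8) by (auto simp: valid_adjustment_set_def)
  have cond: "cond_cov M V = partial_cov"
    by (intro ext) (simp add: cond_cov_def partial_cov_def)

  \<comment> \<open>The numerator: \<open>T\<close> is irrelevant for \<open>y\<close> given \<open>X \<union> Z2\<close>.\<close>
  have "partial_cov (X \<union> Z2) y t = 0" if t: "t \<in> T" for t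
  proof (rule no_open_walk_partial_cov)
    show "X \<union> Z2 \<subseteq> nodes G" "y \<in> nodes G" "t \<in> nodes G" "y \<notin> X \<union> Z2"
      using assms(2-4,9) Z t y by auto
    show "\<nexists>q. open_walk E (X \<union> Z2) (t # q) \<and> last (t # q) = y"
    proof
      assume "\<exists>q. open_walk E (X \<union> Z2) (t # q) \<and> last (t # q) = y"
      then obtain q where q: "open_walk E (X \<union> Z2) (t # q)" "last (t # q) = y" by blast
      have "hd (rev (t # q)) \<in> Y" "last (rev (t # q)) \<in> T"
        using q(2) y t by (simp_all only: hd_rev last_rev list.sel)
      then show False
        using d_separated_no_open_walk[OF assms(11,3) _ open_walk_rev[OF q(1)]] assms(2) Z by blast
    qed
  qed
  moreover have "y \<notin> T" "X \<union> Z2 \<union> T = X \<union> Z1 \<union> Z2" using Z y assms(9) by auto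
  ultimately have "partial_cov (X \<union> Z1 \<union> Z2) y y = partial_cov (X \<union> Z2) y y"
    using partial_cov_variance_irrelevant[of "X \<union> Z2" T y] assms(2,3) Z y by auto
  moreover have "partial_cov (X \<union> Z1 \<union> Z2) y y \<le> partial_cov (X \<union> Z1) y y"
    using partial_cov_variance_antimono[of "X \<union> Z1" "X \<union> Z1 \<union> Z2" y] assms(2,3) Z y by auto
  ultimately have num: "partial_cov (X \<union> Z2) y y \<le> partial_cov (X \<union> Z1) y y" by simp

  \<comment> \<open>The denominator: \<open>S\<close> is irrelevant for \<open>x\<close> given the other nodes of \<open>X \<union> Z1\<close>.\<close>
  have sep: "partial_cov Z1 s x' = 0" if s: "s \<in> S" and x': "x' \<in> X" for s x'
  proof (rule no_open_walk_partial_cov)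
    show "Z1 \<subseteq> nodes G" "s \<in> nodes G" "x' \<in> nodes G" "s \<notin> Z1"
      using assms(2,10) Z s x' by auto
    show "\<nexists>q. open_walk E Z1 (x' # q) \<and> last (x' # q) = s"
      using d_separated_no_open_walk[OF assms(12,2) Z(1)] s x' by (metis list.sel(1))
  qed
  let ?W = "X - {x}"
  have "partial_cov (?W \<union> Z1) x s = 0" if s: "s \<in> S" for s
  proof (rule partial_cov_weak_union)
    show "?W \<union> Z1 \<subseteq> nodes G" "x \<in> nodes G" "s \<in> nodes G" using assms(2,10) Z s x by auto
    show "partial_cov Z1 x' s = 0" if "x' \<in> insert x ?W" for x'
    proof -
      have "x' \<in> X" "x' \<in> nodes G" "s \<in> nodes G" using that s x assms(2,10) Z by auto
      then show ?thesis using sep[OF s] partial_cov_sym[OF Z(1)] by metis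
    qed
  qed
  moreover have "x \<notin> S" "?W \<union> Z1 \<union> S = ?W \<union> Z1 \<union> Z2" using Z x assms(10) by auto
  ultimately have "partial_cov (?W \<union> Z1 \<union> Z2) x x = partial_cov (?W \<union> Z1) x x"
    using partial_cov_variance_irrelevant[of "?W \<union> Z1" S x] assms(2) Z x by auto
  moreover have "partial_cov (?W \<union> Z1 \<union> Z2) x x \<le> partial_cov (?W \<union> Z2) x x"
    using partial_cov_variance_antimono[of "?W \<union> Z2" "?W \<union> Z1 \<union> Z2" x] assms(2) Z x by auto
  ultimately have den: "partial_cov (?W \<union> Z1) x x \<le> partial_cov (?W \<union> Z2) x x" by simp

  have "0 < partial_cov (?W \<union> Z1) x x"
    using partial_cov_variance_pos[of "?W \<union> Z1" x] assms(2) Z x by auto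
  moreover have "0 \<le> partial_cov (X \<union> Z1) y y"
    using partial_cov_variance_nonneg[of "X \<union> Z1" y] assms(2,3) Z y by auto
  ultimately show "a_var M V X Z2 y x \<le> a_var M V X Z1 y x"
    unfolding a_var_def cond using num den by (intro frac_le)
qed

end
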